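(* Let $\alpha,x_1,\dots,x_n$ be complex parameters, and suppose that none of the denominators in the following identity vanishes. Then $$\begin{aligned} 1=\ & \frac{1}{\prod_{r=1}^{n}(\alpha x_{r})_{\infty}}\sum_{k_1,\dots,k_n\ge0}\ \prod_{1\leq r<s\leq n}\frac{1-q^{k_{r}-k_{s}}x_{r}/x_{s}}{1-x_{r}/x_{s}}\prod_{r,s=1}^{n}\frac{1}{(qx_{r}/x_{s})_{k_{r}}}\\ &\times\prod_{r=1}^{n}\Big\{(1-\alpha x_{r}q^{k_{r}+|\boldsymbol{k}|})(\alpha x_{r})_{|\boldsymbol{k}|}\Big\}\prod_{r=1}^{n}x_{r}^{(n+1)k_{r}-|\boldsymbol{k}|}\\ &\times(-1)^{n|\boldsymbol{k}|}\alpha^{|\boldsymbol{k}|}q^{(n+1)\sum_{r=1}^{n}\binom{k_{r}}{2}+\binom{|\boldsymbol{k}|}{2}+\sum_{r=1}^{n}rk_{r}}. \end{aligned}$$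
   Context: $q$ is a complex number with $0<|q|<1$ and $n\ge1$ is an integer. $(z)_\infty=\prod_{i\ge0}(1-zq^i)$ and $(z)_k=(z)_\infty/(zq^k)_\infty=\prod_{i=0}^{k-1}(1-zq^i)$. $\boldsymbol k=(k_1,\dots,k_n)$ is a multi-index of nonnegative integers and $|\boldsymbol k|=k_1+\cdots+k_n$. *)

theory Defs
  imports "HOL-Analysis.Analysis"
begin

definition qpoch_inf :: "complex \<Rightarrow> complex \<Rightarrow> complex" where
  "qpoch_inf q z = (\<Prod>i. 1 - z * q ^ i)"

(* For 0 < |q| < 1 this equals qpoch_inf q z / qpoch_inf q (z * q ^ k) whenever the latter
   denominator is nonzero. *)
definition qpoch :: "complex \<Rightarrow> complex \<Rightarrow> nat \<Rightarrow> complex" where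
  "qpoch q z k = (\<Prod>i<k. 1 - z * q ^ i)"

definition msize :: "nat \<Rightarrow> (nat \<Rightarrow> nat) \<Rightarrow> nat" where
  "msize n k = (\<Sum>r=1..n. k r)"

(* Each multi-index is represented exactly once: by the function on {1..n} extended by undefined. *)
definition multi_indices :: "nat \<Rightarrow> (nat \<Rightarrow> nat) set" where
  "multi_indices n = {1..n} \<rightarrow>\<^sub>E UNIV"

(* The binomial coefficients are natural numbers; exponents that may be negative are integers and use powi. *)
definition summand :: "nat \<Rightarrow> complex \<Rightarrow> complex \<Rightarrow> (nat \<Rightarrow> complex) \<Rightarrow> (nat \<Rightarrow> nat) \<Rightarrow> complex" where
  "summand n q \<alpha> x k =
     (\<Prod>(r,s)\<in>{(r,s). 1 \<le> r \<and> r < s \<and> s \<le> n}.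
        (1 - q powi (int (k r) - int (k s)) * (x r / x s)) / (1 - x r / x s))
   * (\<Prod>r=1..n. \<Prod>s=1..n. 1 / qpoch q (q * x r / x s) (k r))
   * (\<Prod>r=1..n. (1 - \<alpha> * x r * q ^ (k r + msize n k)) * qpoch q (\<alpha> * x r) (msize n k))
   * (\<Prod>r=1..n. x r powi ((int n + 1) * int (k r) - int (msize n k)))
   * (-1) ^ (n * msize n k) * \<alpha> ^ msize n k
   * q ^ ((n + 1) * (\<Sum>r=1..n. k r choose 2) + (msize n k choose 2) + (\<Sum>r=1..n. r * k r))"

end

theory Submission
  imports Defs "HOL-Computational_Algebra.Polynomial"
begin

text \<open>
  The identity is the limit \<open>N \<rightarrow> \<infinity>\<close> of a terminating one, obtained by weighting the summand with
  \<open>\<Prod>\<^sub>r\<^sub>,\<^sub>s (q\<^sup>-\<^sup>N x\<^sub>r / x\<^sub>s)\<^sub>k\<close> (where \<open>k = k\<^sub>r\<close>), suitably normalised, and dividing it by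
  \<open>\<Prod>\<^sub>r (\<alpha> x\<^sub>r)\<^sub>m\<close> with \<open>m = |k| + N + 1\<close>; only \<open>k \<in> {0..N}\<^sup>n\<close> contribute. After clearing denominators, the
  terminating identity equates two polynomials in \<open>\<alpha>\<close> of degree at most \<open>d = n((n + 1)N + 1)\<close>. They agree
  at \<open>\<alpha> = 0\<close> and at the \<open>d\<close> points \<open>\<alpha> = 1 / (x\<^sub>i q\<^sup>M)\<close> with \<open>M \<le> (n + 1)N\<close>: there the product side
  vanishes, and the terms of the sum cancel in pairs under the involution that replaces \<open>k\<^sub>i\<close> by
  \<open>M - |k|\<close>. Dominated convergence then gives the theorem.
\<close>

section \<open>The summand as a Vandermonde quotient\<close>

definition vandermonde :: "nat \<Rightarrow> (nat \<Rightarrow> complex) \<Rightarrow> complex" where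
  "vandermonde n z = (\<Prod>(r,s)\<in>{(r,s). 1 \<le> r \<and> r < s \<and> s \<le> n}. z s - z r)"

lemma finite_pairs: "finite {(r,s). 1 \<le> r \<and> r < s \<and> s \<le> (n::nat)}"
  by (rule finite_subset[of _ "{1..n} \<times> {1..n}"]) auto

text \<open>Only the pairs containing \<open>i\<close> involve the new value \<open>w\<close>, and
  those with \<open>i\<close> as first entry cost a sign each. With the signs and all other pairs
  collected in \<open>K\<close>, the dependence of the summand on a single \<open>k i\<close>
  becomes explicit.\<close>

lemma vandermonde_update:
  assumes i: "i \<in> {1..n}"
  shows "\<exists>K. \<forall>w. vandermonde n (z(i := w)) = K * (\<Prod>j\<in>{1..n}-{i}. w - z j)"
proof -
  define A where "A = {(r,s). 1 \<le> r \<and> r < s \<and> s \<le> n \<and> r \<noteq> i \<and> s \<noteq> i}"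
  define K where "K = (\<Prod>(r,s)\<in>A. z s - z r) * (\<Prod>j\<in>{i<..n}. -1)"
  have fin: "finite A"
    by (rule finite_subset[OF _ finite_pairs[of n]]) (auto simp: A_def)
  have split: "{(r,s). 1 \<le> r \<and> r < s \<and> s \<le> n} = A \<union> ((\<lambda>j. (j,i)) ` {1..<i} \<union> (\<lambda>j. (i,j)) ` {i<..n})"
    using i by (auto simp: A_def)
  have J: "{1..n} - {i} = {1..<i} \<union> {i<..n}"
    using i by auto
  have "vandermonde n (z(i := w)) = K * (\<Prod>j\<in>{1..n}-{i}. w - z j)" for w
  proof -
    have "vandermonde n (z(i := w)) = (\<Prod>(r,s)\<in>A. (z(i := w)) s - (z(i := w)) r)
      * ((\<Prod>j\<in>{1..<i}. w - z j) * (\<Prod>j\<in>{i<..n}. z j - w))"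
      unfolding vandermonde_def split using fin
      by (subst prod.union_disjoint; (subst prod.union_disjoint)?)
         (auto simp: A_def prod.reindex inj_on_def intro!: arg_cong2[of _ _ _ _ "(*)"] prod.cong)
    also have "(\<Prod>(r,s)\<in>A. (z(i := w)) s - (z(i := w)) r) = (\<Prod>(r,s)\<in>A. z s - z r)"
      by (intro prod.cong) (auto simp: A_def)
    also have "(\<Prod>j\<in>{i<..n}. z j - w) = (\<Prod>j\<in>{i<..n}. -1) * (\<Prod>j\<in>{i<..n}. w - z j)"
      unfolding prod.distrib[symmetric] by (intro prod.cong) auto
    finally show ?thesis
      unfolding J K_def by (subst prod.union_disjoint) (auto simp del: fun_upd_apply)
  qed
  then show ?thesis by blast
qed

text \<open>An index \<open>s\<close> is the larger entry of exactly \<open>s - 1\<close> pairs.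
  This evaluates the denominators \<open>q ^ k s\<close> left over when the pair factors are turned
  into Vandermonde factors.\<close>

lemma prod_pairs_snd:
  fixes f :: "nat \<Rightarrow> 'a::comm_monoid_mult"
  shows "(\<Prod>(r,s)\<in>{(r,s). 1 \<le> r \<and> r < s \<and> s \<le> n}. f s) = (\<Prod>s=1..n. f s ^ (s - 1))"
proof -
  have "{(r,s). 1 \<le> r \<and> r < s \<and> s \<le> n} = prod.swap ` (SIGMA s:{1..n}. {1..<s})"
    by (auto simp: image_iff)
  then have "(\<Prod>(r,s)\<in>{(r,s). 1 \<le> r \<and> r < s \<and> s \<le> n}. f s) = (\<Prod>(s,r)\<in>(SIGMA s:{1..n}. {1..<s}). f s)"
    by (simp add: prod.reindex inj_on_def case_prod_unfold)
  also have "\<dots> = (\<Prod>s=1..n. \<Prod>r\<in>{1..<s}. f s)"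
    by (subst prod.Sigma) auto
  finally show ?thesis by simp
qed

text \<open>The part of the summand free of \<alpha>. Apart from the Vandermonde quotient and the
  last power of \<open>q\<close>, every factor involves one \<open>k r\<close> only, which suits
  both varying a single index and bounding by a product over \<open>r\<close>.\<close>

definition summand_coeff :: "nat \<Rightarrow> complex \<Rightarrow> (nat \<Rightarrow> complex) \<Rightarrow> (nat \<Rightarrow> nat) \<Rightarrow> complex" where
  "summand_coeff n q x k =
     vandermonde n (\<lambda>r. x r * q ^ k r) / vandermonde n x
   * (\<Prod>r=1..n. \<Prod>s=1..n. 1 / qpoch q (q * x r / x s) (k r))
   * (\<Prod>r=1..n. ((-1) ^ n * x r ^ (n + 1) * q / (\<Prod>s=1..n. x s)) ^ k r * q ^ ((n + 1) * (k r choose 2)))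
   * q ^ (msize n k choose 2)"

lemma summand_eq_coeff:
  assumes q: "q \<noteq> 0" and x: "\<And>r. r \<in> {1..n} \<Longrightarrow> x r \<noteq> 0"
  shows "summand n q \<alpha> x k = summand_coeff n q x k * \<alpha> ^ msize n k
    * (\<Prod>r=1..n. (1 - \<alpha> * x r * q ^ (k r + msize n k)) * qpoch q (\<alpha> * x r) (msize n k))"
proof -
  define P where "P = {(r,s). 1 \<le> r \<and> r < s \<and> s \<le> n}"
  define m where "m = msize n k"
  define X where "X = (\<Prod>s=1..n. x s)"
  have X: "X \<noteq> 0"
    using x by (auto simp: X_def)
  have quot: "(1 - q powi (int (k r) - int (k s)) * (x r / x s)) / (1 - x r / x s)
      = (x s * q ^ k s - x r * q ^ k r) / (x s - x r) / q ^ k s"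
    if "(r, s) \<in> P" for r s
  proof -
    have "x s \<noteq> 0" "x r \<noteq> 0"
      using that x by (auto simp: P_def)
    then have "1 - q powi (int (k r) - int (k s)) * (x r / x s) = (x s * q ^ k s - x r * q ^ k r) / (x s * q ^ k s)"
      and "1 - x r / x s = (x s - x r) / x s"
      using q by (simp_all add: power_int_diff field_simps)
    then show ?thesis
      using \<open>x s \<noteq> 0\<close> by simp
  qed
  have "(\<Prod>(r,s)\<in>P. (1 - q powi (int (k r) - int (k s)) * (x r / x s)) / (1 - x r / x s))
      = (\<Prod>(r,s)\<in>P. (x s * q ^ k s - x r * q ^ k r) / (x s - x r) / q ^ k s)"
    using quot by (intro prod.cong refl) (clarsimp simp only: case_prod_conv)
  also have "\<dots> = vandermonde n (\<lambda>r. x r * q ^ k r) / vandermonde n x / (\<Prod>(r,s)\<in>P. q ^ k s)"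
    unfolding vandermonde_def P_def case_prod_unfold prod_dividef ..
  also have "(\<Prod>(r,s)\<in>P. q ^ k s) = (\<Prod>s=1..n. (q ^ k s) ^ (s - 1))"
    unfolding P_def by (rule prod_pairs_snd)
  also have "\<dots> = q ^ (\<Sum>s=1..n. k s * (s - 1))"
    by (simp add: power_sum power_mult)
  finally have V: "(\<Prod>(r,s)\<in>P. (1 - q powi (int (k r) - int (k s)) * (x r / x s)) / (1 - x r / x s))
      = vandermonde n (\<lambda>r. x r * q ^ k r) / vandermonde n x / q ^ (\<Sum>s=1..n. k s * (s - 1))" .
  \<comment> \<open>The weight r of \<open>k r\<close> splits as (r - 1) + 1: the first part cancels
    the denominator in \<open>V\<close>, the second supplies the factor \<open>q\<close> in the
    bases of \<open>summand_coeff\<close>.\<close>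
  have W: "q ^ (\<Sum>r=1..n. r * k r) = q ^ (\<Sum>s=1..n. k s * (s - 1)) * q ^ m"
  proof -
    have "(\<Sum>r=1..n. r * k r) = (\<Sum>s=1..n. k s * (s - 1) + k s)"
      by (intro sum.cong) (auto simp: algebra_simps)
    then show ?thesis
      by (simp add: sum.distrib power_add m_def msize_def)
  qed
  have "(\<Prod>r=1..n. x r powi ((int n + 1) * int (k r) - int m)) = (\<Prod>r=1..n. (x r ^ (n + 1)) ^ k r / x r ^ m)"
  proof (intro prod.cong refl)
    fix r assume "r \<in> {1..n}"
    have "(int n + 1) * int (k r) = int ((n + 1) * k r)"
      by (simp add: algebra_simps)
    then show "x r powi ((int n + 1) * int (k r) - int m) = (x r ^ (n + 1)) ^ k r / x r ^ m"
      using x[OF \<open>r \<in> _\<close>] by (simp only: power_int_diff power_int_of_nat power_mult simp_thms)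
  qed
  also have "\<dots> = (\<Prod>r=1..n. (x r ^ (n + 1)) ^ k r) / X ^ m"
    by (simp add: prod_dividef X_def prod_power_distrib)
  finally have Y: "(\<Prod>r=1..n. x r powi ((int n + 1) * int (k r) - int m)) = (\<Prod>r=1..n. (x r ^ (n + 1)) ^ k r) / X ^ m" .
  have pm: "(\<Prod>r=1..n. a ^ k r) = a ^ m" for a :: complex
    by (simp add: power_sum m_def msize_def)
  have "(\<Prod>r=1..n. ((-1) ^ n * x r ^ (n + 1) * q / X) ^ k r * q ^ ((n + 1) * (k r choose 2)))
      = (\<Prod>r=1..n. (((-1) ^ n) ^ k r * (x r ^ (n + 1)) ^ k r * q ^ k r / X ^ k r) * q ^ ((n + 1) * (k r choose 2)))"
    by (intro prod.cong) (simp_all add: power_mult_distrib power_divide)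
  also have "\<dots> = ((-1) ^ n) ^ m * (\<Prod>r=1..n. (x r ^ (n + 1)) ^ k r) * q ^ m / X ^ m * q ^ ((n + 1) * (\<Sum>r=1..n. k r choose 2))"
    by (simp only: prod.distrib prod_dividef pm sum_distrib_left power_sum)
  finally have Z: "(\<Prod>r=1..n. ((-1) ^ n * x r ^ (n + 1) * q / X) ^ k r * q ^ ((n + 1) * (k r choose 2)))
    = ((-1) ^ n) ^ m * (\<Prod>r=1..n. (x r ^ (n + 1)) ^ k r) * q ^ m / X ^ m * q ^ ((n + 1) * (\<Sum>r=1..n. k r choose 2))" .
  show ?thesis
    unfolding summand_def summand_coeff_def P_def[symmetric] m_def[symmetric] X_def[symmetric] V Y Z
    unfolding power_add power_mult W using q by simp
qed

section \<open>Splitting and inverting finite q-Pochhammer symbols\<close>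

lemma qpoch_nz_iff: "qpoch q z m \<noteq> 0 \<longleftrightarrow> (\<forall>i<m. z * q ^ i \<noteq> 1)"
  by (auto simp: qpoch_def)

lemma qpoch_add: "qpoch q z (a + b) = qpoch q z a * (\<Prod>t\<in>{a..<a+b}. 1 - z * q ^ t)"
  unfolding qpoch_def
  by (subst prod.union_disjoint[symmetric]) (auto intro!: prod.cong)

lemma qpoch_top_factors:
  assumes "p \<le> L"
  shows "qpoch q y L = qpoch q y (L - p) * (\<Prod>t<p. 1 - y * q ^ (L - 1 - t))"
proof -
  have "(\<Prod>t<p. 1 - y * q ^ (L - 1 - t)) = (\<Prod>t\<in>{L-p..<L-p+p}. 1 - y * q ^ t)"
    by (rule prod.reindex_bij_witness[of _ "\<lambda>t. L - 1 - t" "\<lambda>t. L - 1 - t"]) (use assms in auto)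
  then show ?thesis
    using qpoch_add[of q y "L - p" p] assms by simp
qed

text \<open>Reversing the factors turns the exponents u - m into -(u + 1). Each factor 1 - y /
  q^(u+1) is then -y / q^(u+1) times 1 - q^(u+1) / y, and (m choose 2) + m is the sum 1 + ... + m of
  the collected exponents.\<close>

lemma qpoch_shift_down:
  assumes q: "q \<noteq> 0" and y: "y \<noteq> 0"
  shows "(\<Prod>u<m. 1 - y * q ^ u / q ^ m) * q ^ ((m choose 2) + m) = (- y) ^ m * qpoch q (q / y) m"
proof -
  have "(\<Prod>u<m. 1 - y * q ^ u / q ^ m) = (\<Prod>u<m. 1 - y / q ^ Suc u)"
    by (rule prod.reindex_bij_witness[of _ "\<lambda>u. m - 1 - u" "\<lambda>u. m - 1 - u"])
       (use q in \<open>auto simp: field_simps simp flip: power_add power_Suc\<close>)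
  also have "\<dots> = (\<Prod>u<m. (- y) * (1 - q / y * q ^ u) / q ^ Suc u)"
    using q y by (intro prod.cong) (auto simp: field_simps)
  also have "\<dots> = (- y) ^ m * qpoch q (q / y) m / (\<Prod>u<m. q ^ Suc u)"
    unfolding prod_dividef prod.distrib qpoch_def by simp
  also have "(\<Prod>u<m. q ^ Suc u) = q ^ ((m choose 2) + m)"
    by (induction m) (auto simp: power_add numeral_2_eq_2)
  finally show ?thesis using q by simp
qed

text \<open>Among the exponents -m, ..., N - m the negative ones are inverted by
  \<open>qpoch_shift_down\<close>; the others form an ordinary symbol of length N + 1 - m. Such
  windows of N + 1 factors are what \<open>cleared_summand\<close> omits.\<close>

lemma qpoch_window:
  assumes q: "q \<noteq> 0" and y: "y \<noteq> 0" and m: "m \<le> N"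
  shows "(\<Prod>t\<le>N. 1 - y * q ^ t / q ^ m) * q ^ ((m choose 2) + m)
      = (- y) ^ m * qpoch q (q / y) m * qpoch q y (N + 1 - m)"
proof -
  have "(\<Prod>t\<le>N. 1 - y * q ^ t / q ^ m) = (\<Prod>t<m. 1 - y * q ^ t / q ^ m) * (\<Prod>t\<in>{m..N}. 1 - y * q ^ t / q ^ m)"
    by (subst prod.union_disjoint[symmetric]) (use m in \<open>auto intro!: prod.cong\<close>)
  also have "(\<Prod>t\<in>{m..N}. 1 - y * q ^ t / q ^ m) = qpoch q y (N + 1 - m)"
    unfolding qpoch_def
    by (rule prod.reindex_bij_witness[of _ "\<lambda>t. t + m" "\<lambda>t. t - m"])
       (use q m in \<open>auto simp: field_simps simp flip: power_add\<close>)
  finally show ?thesis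
    using qpoch_shift_down[OF q y, of m] by (simp add: mult_ac)
qed

text \<open>The window for y = 1 with its vanishing factor \<open>t = m\<close> taken out; the upper
  part therefore starts at exponent 1 and has length N - m.\<close>

lemma qpoch_window_one:
  assumes q: "q \<noteq> 0" and m: "m \<le> N"
  shows "(\<Prod>t\<in>{..N}-{m}. 1 - q ^ t / q ^ m) * q ^ ((m choose 2) + m)
      = (- 1) ^ m * qpoch q q m * qpoch q q (N - m)"
proof -
  have "(\<Prod>t\<in>{..N}-{m}. 1 - q ^ t / q ^ m) = (\<Prod>t<m. 1 - q ^ t / q ^ m) * (\<Prod>t\<in>{m<..N}. 1 - q ^ t / q ^ m)"
    by (subst prod.union_disjoint[symmetric]) (use m in \<open>auto intro!: prod.cong\<close>)
  also have "(\<Prod>t\<in>{m<..N}. 1 - q ^ t / q ^ m) = qpoch q q (N - m)"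
    unfolding qpoch_def
    by (rule prod.reindex_bij_witness[of _ "\<lambda>t. t + m + 1" "\<lambda>t. t - m - 1"])
       (use q m in \<open>auto simp: field_simps simp flip: power_add power_Suc\<close>)
  finally show ?thesis
    using qpoch_shift_down[OF q, of 1 m] by (simp add: mult_ac)
qed

section \<open>The terminating identity\<close>

lemma choose_two_add: "(a + b) choose 2 = (a choose 2) + (b choose 2) + a * b"
  by (induction b) (auto simp: numeral_2_eq_2)

lemma choose_two_square: "p + 2 * (p choose 2) = p * p"
  by (induction p) (auto simp: numeral_2_eq_2)

text \<open>By \<open>separated\<close>, no ratio of two different \<open>x r\<close> is an integer
  power of \<open>q\<close>. This keeps the interpolation points 1 / (x_i q^M) distinct and the
  symbols in \<open>x r / x s\<close> nonzero.\<close>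

locale generic_points =
  fixes n :: nat and q :: complex and x :: "nat \<Rightarrow> complex"
  assumes q_nz: "q \<noteq> 0" and q_lt_1: "norm q < 1"
    and x_nz: "r \<in> {1..n} \<Longrightarrow> x r \<noteq> 0"
    and separated: "r \<in> {1..n} \<Longrightarrow> s \<in> {1..n} \<Longrightarrow> r \<noteq> s \<Longrightarrow> x r * q ^ a \<noteq> x s * q ^ b"
begin

lemma q_power_inj: "q ^ a = q ^ b \<longleftrightarrow> a = b"
proof -
  have "norm q > 0" using q_nz by simp
  then have "norm q ^ a = norm q ^ b \<longleftrightarrow> a = b"
    using q_lt_1 by (simp add: power_inject_exp')
  then show ?thesis by (metis norm_power)
qed

lemma qpoch_q_nz: "qpoch q q m \<noteq> 0"
  using q_power_inj[of "Suc _" 0] by (simp add: qpoch_nz_iff)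

lemma qpoch_ratio_nz:
  assumes "r \<in> {1..n}" "s \<in> {1..n}" "r \<noteq> s"
  shows "qpoch q (x r / x s) m \<noteq> 0" "qpoch q (q / (x r / x s)) m \<noteq> 0"
proof -
  have x: "x r \<noteq> 0" "x s \<noteq> 0" using x_nz assms by auto
  have "x r / x s * q ^ i \<noteq> 1" for i
    using separated[OF assms, of i 0] x by (simp add: field_simps)
  then show "qpoch q (x r / x s) m \<noteq> 0"
    by (simp add: qpoch_nz_iff)
  have "q / (x r / x s) * q ^ i \<noteq> 1" for i
    using separated[OF assms, of 0 "Suc i"] x by (auto simp: field_simps)
  then show "qpoch q (q / (x r / x s)) m \<noteq> 0"
    by (simp add: qpoch_nz_iff)
qed

text \<open>The product of the \<open>(q\<^sup>-\<^sup>N x\<^sub>r / x\<^sub>s)\<^sub>k\<close> with \<open>k = k\<^sub>r\<close>, normalised to tend to 1 as \<open>N\<close> grows;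
  it vanishes as soon as some \<open>k\<^sub>r\<close> exceeds \<open>N\<close>, through the factor \<open>r = s\<close>, \<open>t = N\<close>.\<close>

definition truncation_factor :: "nat \<Rightarrow> (nat \<Rightarrow> nat) \<Rightarrow> complex" where
  "truncation_factor N k = (\<Prod>r=1..n. \<Prod>s=1..n. \<Prod>t<k r. 1 - q ^ (N - t) * (x s / x r))"

text \<open>The quotient of the symbols of lengths |k| and |k| + N + 1 leaves the window of
  exponents |k|, ..., |k| + N in the denominator. Multiplying by the symbols of length (n + 1) N + 1
  replaces it by the complementary product, so the result is a polynomial in \<alpha>.\<close>

definition cleared_summand :: "nat \<Rightarrow> complex \<Rightarrow> (nat \<Rightarrow> nat) \<Rightarrow> complex" where
  "cleared_summand N \<alpha> k = summand_coeff n q x k * truncation_factor N k * \<alpha> ^ msize n k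
    * (\<Prod>r=1..n. (1 - \<alpha> * x r * q ^ (k r + msize n k))
        * (\<Prod>M\<in>{..(n+1)*N} - {msize n k..msize n k + N}. 1 - \<alpha> * x r * q ^ M))"

text \<open>Bookkeeping of signs and powers at the root. The monomials attached to
  \<open>p = k i\<close> and those produced by the window formulas for \<open>m\<close> look
  different, but the value of \<alpha> makes them the same function of \<open>p\<close> and of
  \<open>m\<close>, up to the symmetric factor \<open>q ^ (p * m)\<close>.\<close>

lemma root_monomial:
  fixes i R p m :: nat
  defines "X \<equiv> (\<Prod>s=1..n. x s)" and "M \<equiv> R + p + m" and "J \<equiv> {1..n} - {i}"
  defines "\<alpha> \<equiv> 1 / (x i * q ^ M)" and "h \<equiv> card J" and "c \<equiv> (-1) ^ n * x i ^ n / X"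
  assumes i: "i \<in> {1..n}"
  shows "((-1) ^ n * x i ^ (n + 1) * q / X) ^ p * q ^ ((n + 1) * (p choose 2)) * q ^ (R + p choose 2) * \<alpha> ^ (R + p)
      * (q ^ ((m choose 2) + m)) ^ h * q ^ ((m choose 2) + m)
      / ((x i * q ^ m) ^ h * q ^ m * ((\<Prod>j\<in>J. - (x j / x i)) ^ m * (-1) ^ m))
    = \<alpha> ^ R * q ^ (R choose 2) / x i ^ h
      * (c ^ p * q ^ (n * (p choose 2))) * (c ^ m * q ^ (n * (m choose 2))) / q ^ (p * m)"
proof -
  have xi: "x i \<noteq> 0" using x_nz i by auto
  have n: "n = Suc h"
    using i unfolding h_def J_def by (simp add: card_Diff_singleton)
  have XJ: "X = x i * (\<Prod>j\<in>J. x j)"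
    unfolding X_def J_def using i by (simp add: prod.remove)
  have Jnz: "(\<Prod>j\<in>J. x j) \<noteq> 0"
    unfolding J_def using x_nz by auto
  have Y: "(\<Prod>j\<in>J. - (x j / x i)) = (-1) ^ h * (\<Prod>j\<in>J. x j) / x i ^ h"
  proof -
    have "(\<Prod>j\<in>J. - (x j / x i)) = (\<Prod>j\<in>J. (-1) * x j / x i)"
      by simp
    also have "\<dots> = (\<Prod>j\<in>J. -1) * (\<Prod>j\<in>J. x j) / (\<Prod>j\<in>J. x i)"
      unfolding prod_dividef prod.distrib ..
    finally show ?thesis by (simp add: h_def)
  qed
  \<comment> \<open>The separate -1 is the missing factor for \<open>j = i\<close>, so this is the
    product of -(x_j / x_i) over all j, the inverse of \<open>c\<close>.\<close>
  have "(\<Prod>j\<in>J. - (x j / x i)) * (-1) * c = 1"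
    unfolding Y c_def XJ n using xi Jnz by (simp add: field_simps flip: power_mult_distrib)
  then have Yc: "1 / ((\<Prod>j\<in>J. - (x j / x i)) ^ m * (-1) ^ m) = c ^ m"
    unfolding divide_inverse mult_1_left
    by (intro inverse_unique) (metis power_mult_distrib power_one)
  have b: "(-1) ^ n * x i ^ (n + 1) * q / X = c * x i * q"
    by (simp add: c_def)
  have e1: "q ^ p * q ^ ((n + 1) * (p choose 2)) * q ^ (R + p choose 2) * q ^ (p * m)
      = q ^ (R choose 2) * q ^ (n * (p choose 2)) * q ^ (M * p)"
  proof -
    \<comment> \<open>The square p + 2 (p choose 2) = p p completes R p + p m to M p, which cancels
      against \<open>\<alpha> ^ p\<close> by \<open>ap\<close>.\<close>
    have "p + (n + 1) * (p choose 2) + (R + p choose 2) + p * m = (R choose 2) + n * (p choose 2) + M * p"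
      using choose_two_square[of p] by (simp add: choose_two_add M_def algebra_simps)
    then show ?thesis unfolding power_add[symmetric] by (simp only:)
  qed
  have e2: "(q ^ ((m choose 2) + m)) ^ h * q ^ ((m choose 2) + m) = q ^ (n * (m choose 2)) * (q ^ m) ^ h * q ^ m"
    by (simp add: n power_add power_mult_distrib mult_ac flip: power_mult)
  have ap: "\<alpha> ^ p * (x i ^ p * q ^ (M * p)) = 1"
    using xi q_nz by (simp add: \<alpha>_def power_mult field_simps)
  have "((-1) ^ n * x i ^ (n + 1) * q / X) ^ p * q ^ ((n + 1) * (p choose 2)) * q ^ (R + p choose 2) * \<alpha> ^ (R + p) * q ^ (p * m)
      = c ^ p * x i ^ p * \<alpha> ^ p * \<alpha> ^ R * (q ^ p * q ^ ((n + 1) * (p choose 2)) * q ^ (R + p choose 2) * q ^ (p * m))"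
    unfolding b unfolding power_mult_distrib power_add by (simp add: mult_ac)
  also have "\<dots> = c ^ p * \<alpha> ^ R * (q ^ (R choose 2) * q ^ (n * (p choose 2))) * (\<alpha> ^ p * (x i ^ p * q ^ (M * p)))"
    unfolding e1 by (simp add: mult_ac)
  finally have P: "((-1) ^ n * x i ^ (n + 1) * q / X) ^ p * q ^ ((n + 1) * (p choose 2)) * q ^ (R + p choose 2) * \<alpha> ^ (R + p)
      = c ^ p * \<alpha> ^ R * (q ^ (R choose 2) * q ^ (n * (p choose 2))) / q ^ (p * m)"
    unfolding ap using q_nz by (simp add: field_simps)
  have "(q ^ ((m choose 2) + m)) ^ h * q ^ ((m choose 2) + m)
      / ((x i * q ^ m) ^ h * q ^ m * ((\<Prod>j\<in>J. - (x j / x i)) ^ m * (-1) ^ m))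
      = q ^ (n * (m choose 2)) / x i ^ h * (1 / ((\<Prod>j\<in>J. - (x j / x i)) ^ m * (-1) ^ m))"
    unfolding e2 using q_nz by (simp add: power_mult_distrib)
  then have Q: "(q ^ ((m choose 2) + m)) ^ h * q ^ ((m choose 2) + m)
      / ((x i * q ^ m) ^ h * q ^ m * ((\<Prod>j\<in>J. - (x j / x i)) ^ m * (-1) ^ m))
      = q ^ (n * (m choose 2)) / x i ^ h * c ^ m"
    unfolding Yc .
  show ?thesis
    using arg_cong2[OF P Q, of "(*)"] by (simp add: mult_ac)
qed

text \<open>For \<open>r = i\<close> the truncation factors are the top \<open>p\<close> factors of
  a symbol of fixed length, hence a quotient of two symbols. The resulting denominator in
  \<open>p\<close> is the one that appears in \<open>m\<close> in
  \<open>linear_factors_at_root\<close>.\<close>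

lemma truncation_factor_update:
  fixes \<kappa> :: "nat \<Rightarrow> nat"
  assumes i: "i \<in> {1..n}" and p: "p \<le> N"
  defines "J \<equiv> {1..n} - {i}" and "k \<equiv> \<kappa>(i := p)"
  shows "(\<Prod>r=1..n. \<Prod>s=1..n. 1 / qpoch q (q * x r / x s) (k r)) * truncation_factor N k
    = (\<Prod>r\<in>J. \<Prod>s=1..n. 1 / qpoch q (q * x r / x s) (\<kappa> r) * (\<Prod>t<\<kappa> r. 1 - q ^ (N - t) * (x s / x r)))
      * ((\<Prod>j\<in>J. qpoch q (x j / x i) (N + 1)) * qpoch q q N)
      / ((\<Prod>j\<in>J. qpoch q (q / (x j / x i)) p * qpoch q (x j / x i) (N + 1 - p)) * (qpoch q q p * qpoch q q (N - p)))"
proof -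
  define F where "F r s l = 1 / qpoch q (q * x r / x s) l * (\<Prod>t<l. 1 - q ^ (N - t) * (x s / x r))" for r s l
  have xi: "x i \<noteq> 0" using x_nz i by auto
  have "(\<Prod>r=1..n. \<Prod>s=1..n. 1 / qpoch q (q * x r / x s) (k r)) * truncation_factor N k
      = (\<Prod>r=1..n. \<Prod>s=1..n. F r s (k r))"
    unfolding truncation_factor_def F_def prod.distrib ..
  also have "\<dots> = (\<Prod>s=1..n. F i s p) * (\<Prod>r\<in>J. \<Prod>s=1..n. F r s (\<kappa> r))"
    unfolding J_def k_def using i by (subst prod.remove[of _ i]) (auto intro!: prod.cong)
  also have "(\<Prod>s=1..n. F i s p) = F i i p * (\<Prod>j\<in>J. F i j p)"
    unfolding J_def using i by (subst prod.remove[of _ i]) auto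
  \<comment> \<open>Here the ratio is 1, and the symbol of 1 with length N + 1 is zero; the symbol
    of \<open>q\<close> with length \<open>N\<close> takes its place.\<close>
  also have "F i i p = qpoch q q N / (qpoch q q p * qpoch q q (N - p))"
  proof -
    have "(\<Prod>t<p. 1 - q * q ^ (N - 1 - t)) = (\<Prod>t<p. 1 - q ^ (N - t))"
      using p by (intro prod.cong) (auto simp flip: power_Suc simp: Suc_diff_Suc)
    then show ?thesis
      using qpoch_top_factors[OF p, of q q] xi qpoch_q_nz by (simp add: F_def)
  qed
  also have "(\<Prod>j\<in>J. F i j p) = (\<Prod>j\<in>J. qpoch q (x j / x i) (N + 1)
      / (qpoch q (q / (x j / x i)) p * qpoch q (x j / x i) (N + 1 - p)))"
  proof (intro prod.cong refl)
    fix j assume j: "j \<in> J"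
    have "qpoch q (x j / x i) (N + 1)
        = qpoch q (x j / x i) (N + 1 - p) * (\<Prod>t<p. 1 - x j / x i * q ^ (N + 1 - 1 - t))"
      by (rule qpoch_top_factors) (use p in simp)
    moreover have "qpoch q (x j / x i) (N + 1 - p) \<noteq> 0"
      using qpoch_ratio_nz(1)[of j i] i j by (auto simp: J_def)
    ultimately show "F i j p = qpoch q (x j / x i) (N + 1)
      / (qpoch q (q / (x j / x i)) p * qpoch q (x j / x i) (N + 1 - p))"
      by (simp add: F_def mult_ac)
  qed
  finally show ?thesis
    unfolding prod_dividef F_def by (simp only: times_divide_eq_left times_divide_eq_right mult_ac divide_divide_eq_left)
qed

text \<open>Since |k| = M - m, the root turns the first factors into differences of
  \<open>x i * q ^ m\<close> and \<open>x j * q ^ \<kappa> j\<close>, and the omitted window into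
  factors with exponents t - m. The product over \<open>S\<close> is the full product, independent
  of \<open>m\<close>, divided by that window.\<close>

lemma linear_factors_at_root:
  fixes R p m :: nat and \<kappa> :: "nat \<Rightarrow> nat"
  assumes i: "i \<in> {1..n}" and m: "m \<le> N" and L: "R + p + N \<le> L"
  defines "J \<equiv> {1..n} - {i}" and "M \<equiv> R + p + m"
  defines "\<alpha> \<equiv> 1 / (x i * q ^ M)" and "S \<equiv> {..L} - {R + p..R + p + N}"
  shows "(\<Prod>r=1..n. (1 - \<alpha> * x r * q ^ ((\<kappa>(i := p)) r + (R + p))) * (\<Prod>M'\<in>S. 1 - \<alpha> * x r * q ^ M'))
    = (q ^ m - q ^ p) * (\<Prod>j\<in>J. x i * q ^ m - x j * q ^ \<kappa> j)
      * ((\<Prod>M'\<in>{..L}-{M}. 1 - \<alpha> * x i * q ^ M') * (\<Prod>j\<in>J. \<Prod>M'\<le>L. 1 - \<alpha> * x j * q ^ M'))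
      * ((q ^ ((m choose 2) + m)) ^ card J * q ^ ((m choose 2) + m))
      / ((x i * q ^ m) ^ card J * q ^ m * ((\<Prod>j\<in>J. - (x j / x i)) ^ m * (-1) ^ m)
        * ((\<Prod>j\<in>J. qpoch q (q / (x j / x i)) m * qpoch q (x j / x i) (N + 1 - m)) * (qpoch q q m * qpoch q q (N - m))))"
    (is "?lhs = ?rhs")
proof -
  have xi: "x i \<noteq> 0" using x_nz i by auto
  define T where "T j = (\<Prod>t\<le>N. 1 - x j / x i * q ^ t / q ^ m)" for j
  define e where "e = q ^ ((m choose 2) + m)"
  define Bm where "Bm = qpoch q q m * qpoch q q (N - m)"
  define Qm where "Qm j = qpoch q (q / (x j / x i)) m * qpoch q (x j / x i) (N + 1 - m)" for j
  have e: "e \<noteq> 0" using q_nz by (simp add: e_def)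
  have Bm: "Bm \<noteq> 0" using qpoch_q_nz by (simp add: Bm_def)
  have sub: "{R + p..R + p + N} \<subseteq> {..L}" using L by auto
  have J: "(1 - \<alpha> * x j * q ^ (\<kappa> j + (R + p))) * (\<Prod>M'\<in>S. 1 - \<alpha> * x j * q ^ M')
      = (x i * q ^ m - x j * q ^ \<kappa> j) / (x i * q ^ m) * (\<Prod>M'\<le>L. 1 - \<alpha> * x j * q ^ M') * e
        / ((- (x j / x i)) ^ m * Qm j)" if j: "j \<in> J" for j
  proof -
    have jn: "j \<in> {1..n}" "j \<noteq> i" and xj: "x j \<noteq> 0"
      using j x_nz by (auto simp: J_def)
    have "T j = (\<Prod>M'\<in>{R + p..R + p + N}. 1 - \<alpha> * x j * q ^ M')"
      unfolding T_def
      by (rule prod.reindex_bij_witness[of _ "\<lambda>t. t - (R + p)" "\<lambda>t. t + (R + p)"])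
         (use q_nz xi in \<open>auto simp: \<alpha>_def M_def field_simps power_add\<close>)
    then have DT: "(\<Prod>M'\<in>S. 1 - \<alpha> * x j * q ^ M') * T j = (\<Prod>M'\<le>L. 1 - \<alpha> * x j * q ^ M')"
      unfolding S_def using prod.subset_diff[OF sub, of "\<lambda>M'. 1 - \<alpha> * x j * q ^ M'"] by simp
    have Te: "T j * e = (- (x j / x i)) ^ m * Qm j"
      unfolding T_def e_def Qm_def using qpoch_window[OF q_nz _ m, of "x j / x i"] xi xj
      by (simp only: divide_eq_0_iff mult.assoc simp_thms)
    have "Qm j \<noteq> 0"
      unfolding Qm_def using qpoch_ratio_nz[of j i] jn i by simp
    then have Tnz: "(- (x j / x i)) ^ m * Qm j \<noteq> 0" "T j \<noteq> 0"
      using Te e xi xj by auto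
    have "1 - \<alpha> * x j * q ^ (\<kappa> j + (R + p)) = (x i * q ^ m - x j * q ^ \<kappa> j) / (x i * q ^ m)"
      using q_nz xi by (simp add: \<alpha>_def M_def power_add field_simps)
    moreover have "(\<Prod>M'\<in>S. 1 - \<alpha> * x j * q ^ M') = (\<Prod>M'\<le>L. 1 - \<alpha> * x j * q ^ M') * e / (T j * e)"
      using DT Tnz(2) e by (simp add: field_simps)
    ultimately show ?thesis unfolding Te by simp
  qed
  have I: "(1 - \<alpha> * x i * q ^ (p + (R + p))) * (\<Prod>M'\<in>S. 1 - \<alpha> * x i * q ^ M')
      = (q ^ m - q ^ p) / q ^ m * (\<Prod>M'\<in>{..L}-{M}. 1 - \<alpha> * x i * q ^ M') * e / ((-1) ^ m * Bm)"
  proof -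
    define T' where "T' = (\<Prod>t\<in>{..N}-{m}. 1 - q ^ t / q ^ m)"
    have T': "T' = (\<Prod>M'\<in>{R + p..R + p + N}-{M}. 1 - \<alpha> * x i * q ^ M')"
      unfolding T'_def
      by (rule prod.reindex_bij_witness[of _ "\<lambda>t. t - (R + p)" "\<lambda>t. t + (R + p)"])
         (use q_nz xi in \<open>auto simp: \<alpha>_def M_def field_simps power_add\<close>)
    have S: "S = ({..L} - {M}) - ({R + p..R + p + N} - {M})"
      unfolding S_def M_def using m by auto
    have DT: "(\<Prod>M'\<in>S. 1 - \<alpha> * x i * q ^ M') * T' = (\<Prod>M'\<in>{..L}-{M}. 1 - \<alpha> * x i * q ^ M')"
      unfolding S T' by (rule prod.subset_diff[symmetric]) (use sub in auto)
    have Te: "T' * e = (-1) ^ m * Bm"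
      unfolding T'_def e_def Bm_def using qpoch_window_one[OF q_nz m] by (simp add: mult.assoc)
    have Tnz: "T' \<noteq> 0" using Te Bm e by auto
    have "1 - \<alpha> * x i * q ^ (p + (R + p)) = (q ^ m - q ^ p) / q ^ m"
      using q_nz xi by (simp add: \<alpha>_def M_def power_add field_simps)
    moreover have "(\<Prod>M'\<in>S. 1 - \<alpha> * x i * q ^ M') = (\<Prod>M'\<in>{..L}-{M}. 1 - \<alpha> * x i * q ^ M') * e / (T' * e)"
      using DT Tnz e by (simp add: field_simps)
    ultimately show ?thesis unfolding Te by simp
  qed
  have "?lhs = (1 - \<alpha> * x i * q ^ (p + (R + p))) * (\<Prod>M'\<in>S. 1 - \<alpha> * x i * q ^ M')
      * (\<Prod>j\<in>J. (1 - \<alpha> * x j * q ^ (\<kappa> j + (R + p))) * (\<Prod>M'\<in>S. 1 - \<alpha> * x j * q ^ M'))"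
    unfolding J_def using i by (subst prod.remove[of _ i]) (auto intro!: prod.cong)
  also have "\<dots> = (q ^ m - q ^ p) / q ^ m * (\<Prod>M'\<in>{..L}-{M}. 1 - \<alpha> * x i * q ^ M') * e / ((-1) ^ m * Bm)
      * (\<Prod>j\<in>J. (x i * q ^ m - x j * q ^ \<kappa> j) / (x i * q ^ m) * (\<Prod>M'\<le>L. 1 - \<alpha> * x j * q ^ M') * e
        / ((- (x j / x i)) ^ m * Qm j))"
    unfolding I using J by (intro arg_cong2[of _ _ _ _ "(*)"] prod.cong refl) auto
  also have "\<dots> = ?rhs"
    unfolding prod_dividef prod.distrib prod_constant e_def[symmetric] Bm_def[symmetric] Qm_def[symmetric] prod_power_distrib
    by (simp only: power_mult_distrib times_divide_eq_left times_divide_eq_right mult_ac divide_divide_eq_left)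
  finally show ?thesis .
qed

text \<open>At the root \<open>1 / (x\<^sub>i q\<^sup>M)\<close> the summand depends on \<open>p = k\<^sub>i\<close> through an expression that is
  antisymmetric in \<open>p\<close> and \<open>m = M - |k|\<close>.\<close>

lemma cleared_summand_at_root:
  fixes \<kappa> :: "nat \<Rightarrow> nat" and M :: nat
  assumes i: "i \<in> {1..n}" and \<kappa>: "\<And>j. j \<in> {1..n} - {i} \<Longrightarrow> \<kappa> j \<le> N"
  defines "R \<equiv> (\<Sum>j\<in>{1..n}-{i}. \<kappa> j)"
  shows "\<exists>K U. \<forall>p m. p \<le> N \<longrightarrow> m \<le> N \<longrightarrow> R + p + m = M \<longrightarrow>
    cleared_summand N (1 / (x i * q ^ M)) (\<kappa>(i := p)) = K * (q ^ m - q ^ p) * U p * U m / q ^ (p * m)"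
proof -
  define J where "J = {1..n} - {i}"
  define h where "h = card J"
  define L where "L = (n + 1) * N"
  define X where "X = (\<Prod>s=1..n. x s)"
  define \<alpha> where "\<alpha> = 1 / (x i * q ^ M)"
  define c where "c = (-1) ^ n * x i ^ n / X"
  define H where "H w = (\<Prod>j\<in>J. x i * q ^ w - x j * q ^ \<kappa> j)" for w
  define Q where "Q w = (\<Prod>j\<in>J. qpoch q (q / (x j / x i)) w * qpoch q (x j / x i) (N + 1 - w)) * (qpoch q q w * qpoch q q (N - w))" for w
  define b where "b r = (-1) ^ n * x r ^ (n + 1) * q / X" for r
  define B where "B = (\<Prod>r\<in>J. b r ^ \<kappa> r * q ^ ((n + 1) * (\<kappa> r choose 2)))"
  define G where "G = (\<Prod>r\<in>J. \<Prod>s=1..n. 1 / qpoch q (q * x r / x s) (\<kappa> r) * (\<Prod>t<\<kappa> r. 1 - q ^ (N - t) * (x s / x r)))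
      * ((\<Prod>j\<in>J. qpoch q (x j / x i) (N + 1)) * qpoch q q N)"
  define D where "D = (\<Prod>M'\<in>{..L}-{M}. 1 - \<alpha> * x i * q ^ M') * (\<Prod>j\<in>J. \<Prod>M'\<le>L. 1 - \<alpha> * x j * q ^ M')"
  obtain V where V: "\<And>w. vandermonde n ((\<lambda>r. x r * q ^ \<kappa> r)(i := w)) = V * (\<Prod>j\<in>J. w - x j * q ^ \<kappa> j)"
    using vandermonde_update[OF i] unfolding J_def by metis
  define K where "K = V / vandermonde n x * G * B * D * (\<alpha> ^ R * q ^ (R choose 2) / x i ^ h)"
  \<comment> \<open>\<open>H\<close> arises from the Vandermonde product at \<open>p\<close> and
    from the linear factors at \<open>m\<close>; \<open>Q\<close> arises from the truncation at
    \<open>p\<close> and from the omitted window at \<open>m\<close>. Hence one \<open>U\<close>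
    serves both, and \<open>K\<close> collects what depends on neither.\<close>
  define U where "U w = c ^ w * q ^ (n * (w choose 2)) * H w / Q w" for w
  have "cleared_summand N \<alpha> (\<kappa>(i := p)) = K * (q ^ m - q ^ p) * U p * U m / q ^ (p * m)"
    if p: "p \<le> N" and m: "m \<le> N" and M: "R + p + m = M" for p m
  proof -
    define k where "k = \<kappa>(i := p)"
    have size: "msize n k = R + p"
      unfolding msize_def k_def R_def using i by (subst sum.remove[of _ i]) (auto intro!: sum.cong)
    have "R \<le> (\<Sum>j\<in>{1..n}-{i}. N)"
      unfolding R_def using \<kappa> by (rule sum_mono)
    \<comment> \<open>\<open>R\<close> has n - 1 terms, so R + p is at most n N and the window stays
      below \<open>L\<close>.\<close>
    then have L: "R + p + N \<le> L"
      using i p by (cases n) (auto simp: L_def algebra_simps)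
    have van: "vandermonde n (\<lambda>r. x r * q ^ k r) = V * H p"
    proof -
      have "(\<lambda>r. x r * q ^ k r) = (\<lambda>r. x r * q ^ \<kappa> r)(i := x i * q ^ p)"
        by (auto simp: k_def)
      then show ?thesis unfolding H_def using V by metis
    qed
    have trunc: "(\<Prod>r=1..n. \<Prod>s=1..n. 1 / qpoch q (q * x r / x s) (k r)) * truncation_factor N k = G / Q p"
      unfolding G_def Q_def J_def k_def by (rule truncation_factor_update[OF i p])
    have pow: "(\<Prod>r=1..n. b r ^ k r * q ^ ((n + 1) * (k r choose 2)))
        = b i ^ p * q ^ ((n + 1) * (p choose 2)) * B"
      unfolding B_def J_def k_def using i by (subst prod.remove[of _ i]) (auto intro!: prod.cong)
    have lin: "(\<Prod>r=1..n. (1 - \<alpha> * x r * q ^ (k r + (R + p)))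
        * (\<Prod>M'\<in>{..L} - {R + p..R + p + N}. 1 - \<alpha> * x r * q ^ M'))
      = (q ^ m - q ^ p) * H m * D * ((q ^ ((m choose 2) + m)) ^ h * q ^ ((m choose 2) + m))
        / ((x i * q ^ m) ^ h * q ^ m * ((\<Prod>j\<in>J. - (x j / x i)) ^ m * (-1) ^ m) * Q m)"
      unfolding k_def H_def D_def h_def Q_def J_def \<alpha>_def M[symmetric]
      by (rule linear_factors_at_root[OF i m L])
    have mono: "b i ^ p * q ^ ((n + 1) * (p choose 2)) * q ^ (R + p choose 2) * \<alpha> ^ (R + p)
      * (q ^ ((m choose 2) + m)) ^ h * q ^ ((m choose 2) + m)
      / ((x i * q ^ m) ^ h * q ^ m * ((\<Prod>j\<in>J. - (x j / x i)) ^ m * (-1) ^ m))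
      = \<alpha> ^ R * q ^ (R choose 2) / x i ^ h
      * (c ^ p * q ^ (n * (p choose 2))) * (c ^ m * q ^ (n * (m choose 2))) / q ^ (p * m)"
      unfolding b_def X_def \<alpha>_def h_def J_def c_def M[symmetric] by (rule root_monomial[OF i])
    have "cleared_summand N \<alpha> k = V * H p / vandermonde n x
        * ((\<Prod>r=1..n. \<Prod>s=1..n. 1 / qpoch q (q * x r / x s) (k r)) * truncation_factor N k)
        * (\<Prod>r=1..n. b r ^ k r * q ^ ((n + 1) * (k r choose 2))) * q ^ (R + p choose 2) * \<alpha> ^ (R + p)
        * (\<Prod>r=1..n. (1 - \<alpha> * x r * q ^ (k r + (R + p)))
        * (\<Prod>M'\<in>{..L} - {R + p..R + p + N}. 1 - \<alpha> * x r * q ^ M'))"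
      unfolding cleared_summand_def summand_coeff_def size van L_def b_def X_def by (simp only: mult_ac)
    also have "\<dots> = V * H p / vandermonde n x * (G / Q p) * B * ((q ^ m - q ^ p) * H m * D) / Q m
        * (b i ^ p * q ^ ((n + 1) * (p choose 2)) * q ^ (R + p choose 2) * \<alpha> ^ (R + p)
      * (q ^ ((m choose 2) + m)) ^ h * q ^ ((m choose 2) + m)
      / ((x i * q ^ m) ^ h * q ^ m * ((\<Prod>j\<in>J. - (x j / x i)) ^ m * (-1) ^ m)))"
      unfolding trunc pow lin by (simp only: times_divide_eq_left times_divide_eq_right mult_ac divide_divide_eq_left)
    also have "\<dots> = K * (q ^ m - q ^ p) * U p * U m / q ^ (p * m)"
      unfolding mono K_def U_def by (simp only: times_divide_eq_left times_divide_eq_right mult_ac divide_divide_eq_left)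
    finally show ?thesis unfolding k_def .
  qed
  then show ?thesis unfolding \<alpha>_def by blast
qed

text \<open>Unless \<open>M\<close> lies in the omitted window, the factor with \<open>r = i\<close>
  and exponent \<open>M\<close> is present and kills the term. For the remaining \<open>k\<close>
  the number m = M - |k| lies in 0..N, so putting it in place of \<open>k i\<close> stays in range
  and exchanges \<open>p\<close> and \<open>m\<close>.\<close>

lemma sum_cleared_summand_at_root:
  assumes i: "i \<in> {1..n}" and M: "M \<le> (n + 1) * N"
  shows "(\<Sum>k\<in>{1..n} \<rightarrow>\<^sub>E {..N}. cleared_summand N (1 / (x i * q ^ M)) k) = 0"
proof -
  define f where "f = cleared_summand N (1 / (x i * q ^ M))"
  define A where "A = {k \<in> {1..n} \<rightarrow>\<^sub>E {..N}. msize n k \<le> M \<and> M \<le> msize n k + N}"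
  define \<phi> where "\<phi> k = k(i := M - msize n k)" for k
  have xi: "x i \<noteq> 0" using x_nz i by auto
  have size: "msize n k = k i + (\<Sum>j\<in>{1..n}-{i}. k j)" for k
    unfolding msize_def using i by (subst sum.remove[of _ i]) auto
  have size_upd: "msize n (k(i := p)) = p + (\<Sum>j\<in>{1..n}-{i}. k j)" for k p
    unfolding size by (auto intro!: sum.cong)
  have fin: "finite ({1..n} \<rightarrow>\<^sub>E {..N})"
    by (intro finite_PiE) auto
  have zero: "f k = 0" if "k \<in> ({1..n} \<rightarrow>\<^sub>E {..N}) - A" for k
  proof -
    define g where "g r = (1 - 1 / (x i * q ^ M) * x r * q ^ (k r + msize n k))
        * (\<Prod>M'\<in>{..(n+1)*N} - {msize n k..msize n k + N}. 1 - 1 / (x i * q ^ M) * x r * q ^ M')" for r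
    have "M \<in> {..(n+1)*N} - {msize n k..msize n k + N}"
      using that M by (auto simp: A_def)
    then have "(\<Prod>M'\<in>{..(n+1)*N} - {msize n k..msize n k + N}. 1 - 1 / (x i * q ^ M) * x i * q ^ M') = 0"
      using xi q_nz by (intro prod_zero) (auto intro!: bexI[of _ M])
    then have "g i = 0"
      by (simp only: g_def mult_zero_right)
    then have "(\<Prod>r=1..n. g r) = 0"
      using i by (intro prod_zero) auto
    then show ?thesis
      unfolding f_def cleared_summand_def g_def by (simp only: mult_zero_right)
  qed
  have A: "\<phi> k \<in> A" "\<phi> (\<phi> k) = k" "f (\<phi> k) = - f k" if k: "k \<in> A" for k
  proof -
    define R where "R = (\<Sum>j\<in>{1..n}-{i}. k j)"
    define m where "m = M - msize n k"
    have bound: "k j \<le> N" if "j \<in> {1..n}" for j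
      using k that by (auto simp: A_def)
    have m: "m \<le> N" "R + k i + m = M"
      using k by (auto simp: A_def m_def R_def size)
    have \<phi>: "\<phi> k = k(i := m)"
      by (simp add: \<phi>_def m_def)
    have sz: "msize n (\<phi> k) = R + m"
      unfolding \<phi> size_upd by (simp add: R_def)
    show "\<phi> k \<in> A"
      using k m i sz bound[OF i] unfolding A_def \<phi> by (auto simp: PiE_iff extensional_def)
    show "\<phi> (\<phi> k) = k"
      using m by (simp add: \<phi>_def[of "\<phi> k"] sz) (auto simp: \<phi>)
    obtain K U where KU: "\<And>p m. p \<le> N \<Longrightarrow> m \<le> N \<Longrightarrow> R + p + m = M \<Longrightarrow>
        f (k(i := p)) = K * (q ^ m - q ^ p) * U p * U m / q ^ (p * m)"
      using cleared_summand_at_root[OF i, of k N M] bound unfolding R_def f_def by blast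
    have "f k = K * (q ^ m - q ^ k i) * U (k i) * U m / q ^ (k i * m)"
      using KU[of "k i" m] m bound[OF i] by simp
    moreover have "f (\<phi> k) = K * (q ^ k i - q ^ m) * U m * U (k i) / q ^ (m * k i)"
      unfolding \<phi> using KU[of m "k i"] m bound[OF i] by simp
    moreover have "K * (q ^ k i - q ^ m) * U m * U (k i) = - (K * (q ^ m - q ^ k i) * U (k i) * U m)"
      by (simp add: algebra_simps)
    ultimately show "f (\<phi> k) = - f k"
      by (simp only: minus_divide_left mult.commute[of m "k i"])
  qed
  have "(\<Sum>k\<in>{1..n} \<rightarrow>\<^sub>E {..N}. f k) = (\<Sum>k\<in>A. f k)"
    by (rule sum.mono_neutral_right[OF fin]) (use zero in \<open>auto simp: A_def\<close>)
  also have "(\<Sum>k\<in>A. f k) = 0"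
  proof -
    \<comment> \<open>The sum equals its own negative. Fixed points of \<open>\<phi>\<close> are
      covered, their terms being zero.\<close>
    have "(\<Sum>k\<in>A. f k) = (\<Sum>k\<in>A. - f k)"
      by (rule sum.reindex_bij_witness[of _ \<phi> \<phi>]) (use A in auto)
    then show ?thesis by (simp add: sum_negf)
  qed
  finally show ?thesis unfolding f_def .
qed

section \<open>Interpolation in \<alpha>\<close>

definition cleared_poly :: "nat \<Rightarrow> (nat \<Rightarrow> nat) \<Rightarrow> complex poly" where
  "cleared_poly N k = smult (summand_coeff n q x k * truncation_factor N k) (monom 1 (msize n k)
    * (\<Prod>r=1..n. [:1, - x r * q ^ (k r + msize n k):]
        * (\<Prod>M\<in>{..(n+1)*N} - {msize n k..msize n k + N}. [:1, - x r * q ^ M:])))"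

lemma poly_linear_factor: "poly [:1, - x r * q ^ M:] \<alpha> = 1 - \<alpha> * x r * q ^ M"
  by simp

lemma poly_cleared_poly: "poly (cleared_poly N k) \<alpha> = cleared_summand N \<alpha> k"
  unfolding cleared_poly_def cleared_summand_def poly_smult poly_mult poly_monom poly_prod poly_linear_factor
  by simp

lemma degree_prod_linear_factors:
  assumes "finite S"
  shows "degree (\<Prod>M\<in>S. [:1, - x r * q ^ M:]) \<le> card S"
proof -
  have "degree (\<Prod>M\<in>S. [:1, - x r * q ^ M:]) \<le> (\<Sum>M\<in>S. degree [:1, - x r * q ^ M:])"
    using degree_prod_sum_le[OF assms, of "\<lambda>M. [:1, - x r * q ^ M:]"] by (simp add: o_def)
  also have "\<dots> \<le> of_nat (card S) * 1"
    by (rule sum_bounded_above) simp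
  finally show ?thesis by simp
qed

text \<open>Omitting N + 1 of the L + 1 exponents and adding one linear factor leaves degree L - N +
  1 for each \<open>r\<close>. The power of \<alpha> adds |k|, at most n N, which makes up exactly
  for the n N lost.\<close>

lemma degree_cleared_poly:
  assumes k: "k \<in> {1..n} \<rightarrow>\<^sub>E {..N}"
  shows "degree (cleared_poly N k) \<le> n * ((n + 1) * N + 1)"
proof -
  define w where "w = msize n k"
  define L where "L = (n + 1) * N"
  have "w \<le> (\<Sum>r=1..n. N)"
    unfolding w_def msize_def by (rule sum_mono) (use k in auto)
  then have w: "w \<le> n * N" by simp
  have lin: "degree [:1, a:] \<le> 1" for a :: complex
    by simp
  have card: "card ({..L} - {w..w + N}) = L - N"
    using w by (subst card_Diff_subset) (auto simp: L_def)
  have inner: "degree (\<Prod>M\<in>{..L} - {w..w + N}. [:1, - x r * q ^ M:]) \<le> L - N" for r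
    using degree_prod_linear_factors[of "{..L} - {w..w + N}" r] card by simp
  have "degree ([:1, - x r * q ^ (k r + w):] * (\<Prod>M\<in>{..L} - {w..w + N}. [:1, - x r * q ^ M:])) \<le> 1 + (L - N)" for r
    by (rule order.trans[OF degree_mult_le add_mono[OF lin inner]])
  then have "degree (\<Prod>r=1..n. [:1, - x r * q ^ (k r + w):] * (\<Prod>M\<in>{..L} - {w..w + N}. [:1, - x r * q ^ M:]))
      \<le> (\<Sum>r=1..n. 1 + (L - N))"
    by (intro order.trans[OF degree_prod_sum_le] sum_mono) (auto simp del: sum_constant)
  moreover have "degree (monom (1::complex) w) \<le> w"
    by (rule degree_monom_le)
  ultimately have "degree (cleared_poly N k) \<le> w + (\<Sum>r=1..n. 1 + (L - N))"
    unfolding cleared_poly_def w_def[symmetric] L_def[symmetric]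
    by (intro order.trans[OF degree_smult_le] order.trans[OF degree_mult_le] add_mono)
  also have "\<dots> \<le> n * (L + 1)"
    using w by (simp add: L_def algebra_simps)
  finally show ?thesis unfolding L_def .
qed

text \<open>The difference \<open>P\<close> of the two sides has degree at most n (L + 1) but one
  more zero than that, namely the points of \<open>Z\<close>.\<close>

lemma sum_cleared_summand:
  "(\<Sum>k\<in>{1..n} \<rightarrow>\<^sub>E {..N}. cleared_summand N \<alpha> k) = (\<Prod>r=1..n. qpoch q (\<alpha> * x r) ((n + 1) * N + 1))"
proof -
  define L where "L = (n + 1) * N"
  define D where "D = (\<Prod>r=1..n. \<Prod>M\<in>{..<L + 1}. [:1, - x r * q ^ M:])"
  define P where "P = (\<Sum>k\<in>{1..n} \<rightarrow>\<^sub>E {..N}. cleared_poly N k) - D"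
  define \<rho> where "\<rho> = (\<lambda>(i, M). 1 / (x i * q ^ M))"
  define Z where "Z = insert 0 (\<rho> ` ({1..n} \<times> {..L}))"
  have fin: "finite ({1..n} \<rightarrow>\<^sub>E {..N})"
    by (intro finite_PiE) auto
  have polyD: "poly D a = (\<Prod>r=1..n. qpoch q (a * x r) (L + 1))" for a
    unfolding D_def poly_prod poly_linear_factor qpoch_def ..
  have polyP: "poly P a = (\<Sum>k\<in>{1..n} \<rightarrow>\<^sub>E {..N}. cleared_summand N a k) - (\<Prod>r=1..n. qpoch q (a * x r) (L + 1))" for a
    by (simp add: P_def polyD poly_sum poly_cleared_poly)
  have "degree (\<Prod>M\<in>{..<L + 1}. [:1, - x r * q ^ M:]) \<le> L + 1" for r
    using degree_prod_linear_factors[of "{..<L + 1}" r] by simp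
  then have "degree D \<le> (\<Sum>r=1..n. L + 1)"
    unfolding D_def by (intro order.trans[OF degree_prod_sum_le] sum_mono) (auto simp del: sum_constant)
  then have deg: "degree P \<le> n * (L + 1)"
    unfolding P_def using degree_cleared_poly
    by (intro degree_diff_le degree_sum_le fin) (auto simp: L_def)
  have inj: "inj_on \<rho> ({1..n} \<times> {..L})"
  proof (rule inj_onI, clarify)
    fix i M j M'
    assume ij: "i \<in> {1..n}" "j \<in> {1..n}" and "\<rho> (i, M) = \<rho> (j, M')"
    then have "x i * q ^ M = x j * q ^ M'" by (simp add: \<rho>_def)
    moreover from this have "i = j" using separated ij by blast
    ultimately show "i = j \<and> M = M'" using x_nz[OF ij(1)] q_power_inj by simp
  qed
  have "0 \<notin> \<rho> ` ({1..n} \<times> {..L})"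
    using x_nz q_nz by (auto simp: \<rho>_def)
  then have card: "card Z = n * (L + 1) + 1"
    unfolding Z_def using inj by (simp add: card_image card_cartesian_product)
  have "poly P z = 0" if zZ: "z \<in> Z" for z
  proof (cases "z = 0")
    case True
    \<comment> \<open>The zero multi-index, extended by \<open>undefined\<close> as the function
      space demands; only it survives at \<alpha> = 0.\<close>
    define k0 where "k0 = (\<lambda>r. if r \<in> {1..n} then 0 else undefined :: nat)"
    have k0: "k0 \<in> {1..n} \<rightarrow>\<^sub>E {..N}"
      by (auto simp: k0_def)
    have "cleared_summand N 0 k = 0" if "k \<in> ({1..n} \<rightarrow>\<^sub>E {..N}) - {k0}" for k
    proof -
      have "msize n k \<noteq> 0"
      proof
        assume "msize n k = 0"
        then have "k r = k0 r" for r
          using that by (cases "r \<in> {1..n}") (auto simp: msize_def k0_def)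
        then show False using that by auto
      qed
      then show ?thesis by (simp add: cleared_summand_def)
    qed
    then have "(\<Sum>k\<in>{1..n} \<rightarrow>\<^sub>E {..N}. cleared_summand N 0 k) = (\<Sum>k\<in>{k0}. cleared_summand N 0 k)"
      by (intro sum.mono_neutral_right fin) (use k0 in auto)
    also have "\<dots> = 1"
    proof -
      have "vandermonde n x \<noteq> 0"
        unfolding vandermonde_def prod_zero_iff[OF finite_pairs] using separated[of _ _ 0 0] by force
      moreover have "vandermonde n (\<lambda>r. x r * q ^ k0 r) = vandermonde n x"
        unfolding vandermonde_def by (intro prod.cong) (auto simp: k0_def)
      moreover have "msize n k0 = 0"
        by (simp add: msize_def k0_def)
      moreover have "truncation_factor N k0 = 1"
        by (simp add: truncation_factor_def k0_def)
      ultimately show ?thesis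
        by (simp add: cleared_summand_def summand_coeff_def k0_def qpoch_def binomial_eq_0)
    qed
    finally show ?thesis
      unfolding True polyP by (simp add: qpoch_def)
  next
    case False
    then obtain i M where i: "i \<in> {1..n}" and M: "M \<le> L" and z: "z = 1 / (x i * q ^ M)"
      using zZ by (auto simp: Z_def \<rho>_def)
    have "qpoch q (z * x i) (L + 1) = 0"
      unfolding qpoch_def using x_nz[OF i] q_nz M by (intro prod_zero) (auto simp: z intro!: bexI[of _ M])
    then have "(\<Prod>r=1..n. qpoch q (z * x r) (L + 1)) = 0"
      using i by (intro prod_zero) auto
    then show ?thesis
      unfolding polyP z using sum_cleared_summand_at_root[OF i] M by (simp add: L_def)
  qed
  then have sub: "Z \<subseteq> {z. poly P z = 0}" by auto
  have "P = 0"
  proof (rule ccontr)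
    assume P: "P \<noteq> 0"
    have "card Z \<le> card {z. poly P z = 0}"
      by (rule card_mono[OF poly_roots_finite[OF P] sub])
    also have "\<dots> \<le> degree P"
      by (rule card_poly_roots_bound[OF P])
    finally show False using deg card by simp
  qed
  then show ?thesis using polyP[of \<alpha>] by (simp add: L_def)
qed

end

section \<open>Passage to the limit\<close>

text \<open>The majorant makes the finite partial sums converge uniformly in \<open>N\<close> by the
  Weierstrass test, so the two limits may be exchanged.\<close>

lemma infsum_dominated_convergence:
  fixes f :: "nat \<Rightarrow> 'a \<Rightarrow> 'b::banach"
  assumes lim: "\<And>k. k \<in> A \<Longrightarrow> (\<lambda>N. f N k) \<longlonglongrightarrow> g k"
    and bound: "\<And>N k. k \<in> A \<Longrightarrow> norm (f N k) \<le> M k"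
    and M: "M summable_on A"
  shows "g summable_on A" "(\<lambda>N. \<Sum>\<^sub>\<infinity>k\<in>A. f N k) \<longlonglongrightarrow> (\<Sum>\<^sub>\<infinity>k\<in>A. g k)"
proof -
  have "norm (g k) \<le> M k" if "k \<in> A" for k
    by (rule Lim_norm_ubound[OF _ lim[OF that]]) (auto simp: bound that)
  then have "(\<lambda>k. norm (g k)) summable_on A"
    by (rule Infinite_Sum.abs_summable_on_comparison_test'[OF M])
  then show g: "g summable_on A"
    by (rule abs_summable_summable)
  show "(\<lambda>N. \<Sum>\<^sub>\<infinity>k\<in>A. f N k) \<longlonglongrightarrow> (\<Sum>\<^sub>\<infinity>k\<in>A. g k)"
  proof (rule swap_uniform_limit')
    show "\<forall>\<^sub>F X in finite_subsets_at_top A. (\<lambda>N. \<Sum>k\<in>X. f N k) \<longlonglongrightarrow> (\<Sum>k\<in>X. g k)"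
      using eventually_finite_subsets_at_top_weakI[of A "\<lambda>X. X \<subseteq> A"]
      by (auto elim!: eventually_mono intro!: tendsto_sum lim)
    show "(sum g \<longlongrightarrow> infsum g A) (finite_subsets_at_top A)"
      using infsum_tendsto[OF g] .
    show "uniform_limit UNIV (\<lambda>X N. \<Sum>k\<in>X. f N k) (\<lambda>N. \<Sum>\<^sub>\<infinity>k\<in>A. f N k) (finite_subsets_at_top A)"
      by (rule Weierstrass_m_test_general[OF _ M]) (rule bound)
  qed auto
qed

lemma summable_on_prod_PiE_nat:
  fixes g :: "'a \<Rightarrow> nat \<Rightarrow> real"
  assumes "finite A" and "\<And>r j. r \<in> A \<Longrightarrow> 0 \<le> g r j" and "\<And>r. r \<in> A \<Longrightarrow> summable (g r)"
  shows "(\<lambda>k. \<Prod>r\<in>A. g r (k r)) summable_on (A \<rightarrow>\<^sub>E UNIV)"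
proof -
  have "Infinite_Set_Sum.abs_summable_on (g r) UNIV" if "r \<in> A" for r
    using assms(2,3)[OF that] by (simp add: abs_summable_on_nat_iff')
  then have "Infinite_Set_Sum.abs_summable_on (\<lambda>k. \<Prod>r\<in>A. g r (k r)) (A \<rightarrow>\<^sub>E UNIV)"
    by (intro abs_summable_on_prod_PiE assms(1)) auto
  then show ?thesis
    unfolding abs_summable_equivalent[symmetric] by (rule abs_summable_summable)
qed

text \<open>The ratio of consecutive terms is a b^j, which tends to 0.\<close>

lemma summable_power_times_quadratic_power:
  fixes a b :: real
  assumes a: "0 \<le> a" and b: "0 \<le> b" "b < 1"
  shows "summable (\<lambda>j. a ^ j * b ^ (j choose 2))"
proof -
  have "(\<lambda>j. a * b ^ j) \<longlonglongrightarrow> a * 0"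
    using b by (intro tendsto_intros LIMSEQ_realpow_zero)
  then have "\<forall>\<^sub>F j in sequentially. a * b ^ j < 1 / 2"
    by (rule order_tendstoD) simp
  then obtain j0 where j0: "\<And>j. j \<ge> j0 \<Longrightarrow> a * b ^ j \<le> 1 / 2"
    by (auto simp: eventually_sequentially intro: less_imp_le)
  show ?thesis
  proof (rule summable_ratio_test)
    show "norm (a ^ Suc j * b ^ (Suc j choose 2)) \<le> 1 / 2 * norm (a ^ j * b ^ (j choose 2))" if "j \<ge> j0" for j
    proof -
      have "a ^ Suc j * b ^ (Suc j choose 2) = (a * b ^ j) * (a ^ j * b ^ (j choose 2))"
        by (simp add: power_add numeral_2_eq_2)
      also have "\<dots> \<le> 1 / 2 * (a ^ j * b ^ (j choose 2))"
        using j0[OF that] a b by (intro mult_right_mono) auto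
      finally show ?thesis using a b by simp
    qed
  qed simp
qed

section \<open>Limits and uniform bounds of q-Pochhammer symbols\<close>

context
  fixes q :: complex
  assumes q_lt_1: "norm q < 1"
begin

lemma convergent_prod_qpoch: "convergent_prod (\<lambda>i. 1 - z * q ^ i)"
proof -
  have "summable (\<lambda>i. norm z * norm q ^ i)"
    using q_lt_1 by (intro summable_mult summable_geometric) simp
  then show ?thesis
    by (intro abs_convergent_prod_imp_convergent_prod summable_imp_abs_convergent_prod)
       (simp add: norm_mult norm_power)
qed

lemma qpoch_tendsto: "(\<lambda>m. qpoch q z m) \<longlonglongrightarrow> qpoch_inf q z"
  using convergent_prod_LIMSEQ[OF convergent_prod_qpoch[of z]]
  unfolding qpoch_def qpoch_inf_def lessThan_Suc_atMost[symmetric] by (subst (asm) filterlim_sequentially_Suc)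

text \<open>A convergent infinite product is zero only if one of its factors is.\<close>

lemma qpoch_inf_nz_iff: "qpoch_inf q z \<noteq> 0 \<longleftrightarrow> (\<forall>m. qpoch q z m \<noteq> 0)"
proof -
  have "(\<lambda>i. 1 - z * q ^ i) has_prod qpoch_inf q z"
    unfolding qpoch_inf_def by (rule convergent_prod_has_prod[OF convergent_prod_qpoch])
  then have "qpoch_inf q z = 0 \<longleftrightarrow> (\<exists>i. 1 - z * q ^ i = 0)"
    by (subst has_prod_eq_0_iff) auto
  then show ?thesis
    unfolding qpoch_def by auto
qed

lemma qpoch_bounded: "\<exists>C\<ge>0. \<forall>m. norm (qpoch q z m) \<le> C"
proof -
  have "Bseq (\<lambda>m. qpoch q z m)"
    using qpoch_tendsto by (intro convergent_imp_Bseq) (auto simp: convergent_def)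
  then obtain C where "\<forall>m. norm (qpoch q z m) \<le> C" "C > 0"
    by (auto elim: BseqE)
  then show ?thesis by (intro exI[of _ C]) auto
qed

lemma inverse_qpoch_bounded:
  assumes "\<And>m. qpoch q z m \<noteq> 0"
  shows "\<exists>C\<ge>0. \<forall>m. norm (1 / qpoch q z m) \<le> C"
proof -
  have "(\<lambda>m. 1 / qpoch q z m) \<longlonglongrightarrow> 1 / qpoch_inf q z"
    using assms qpoch_inf_nz_iff by (intro tendsto_intros qpoch_tendsto) auto
  then have "Bseq (\<lambda>m. 1 / qpoch q z m)"
    by (intro convergent_imp_Bseq) (auto simp: convergent_def)
  then obtain C where "\<forall>m. norm (1 / qpoch q z m) \<le> C" "C > 0"
    by (auto elim: BseqE)
  then show ?thesis by (intro exI[of _ C]) auto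
qed

text \<open>The bound is uniform in \<open>l\<close> and \<open>N\<close>: by 1 + a \<le> exp a it
  suffices to sum the exponents' powers, and the N - t are distinct, so a full geometric series
  dominates.\<close>

lemma top_factors_bounded:
  assumes l: "l \<le> N"
  shows "norm (\<Prod>t<l. 1 - q ^ (N - t) * y) \<le> exp (norm y / (1 - norm q))"
proof -
  have "norm (\<Prod>t<l. 1 - q ^ (N - t) * y) \<le> (\<Prod>t<l. exp (norm q ^ (N - t) * norm y))"
    unfolding prod_norm[symmetric]
  proof (intro prod_mono conjI norm_ge_zero)
    fix t
    have "norm (1 - q ^ (N - t) * y) \<le> 1 + norm q ^ (N - t) * norm y"
      using norm_triangle_ineq4[of 1 "q ^ (N - t) * y"] by (simp add: norm_mult norm_power)
    also have "\<dots> \<le> exp (norm q ^ (N - t) * norm y)"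
      by (rule exp_ge_add_one_self)
    finally show "norm (1 - q ^ (N - t) * y) \<le> exp (norm q ^ (N - t) * norm y)" .
  qed
  also have "\<dots> = exp (norm y * (\<Sum>t<l. norm q ^ (N - t)))"
    by (simp add: exp_sum sum_distrib_left mult.commute)
  also have "(\<Sum>t<l. norm q ^ (N - t)) = (\<Sum>u\<in>(\<lambda>t. N - t) ` {..<l}. norm q ^ u)"
    using l by (subst sum.reindex) (auto simp: inj_on_def)
  also have "\<dots> \<le> (\<Sum>u. norm q ^ u)"
    using q_lt_1 by (intro sum_le_suminf summable_geometric) auto
  also have "\<dots> = 1 / (1 - norm q)"
    using q_lt_1 by (intro suminf_geometric) simp
  finally show ?thesis by (simp add: mult_left_mono)
qed

end

section \<open>Termwise limits and a summable majorant\<close>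

context generic_points
begin

definition truncated_summand :: "complex \<Rightarrow> nat \<Rightarrow> (nat \<Rightarrow> nat) \<Rightarrow> complex" where
  "truncated_summand \<alpha> N k = summand n q \<alpha> x k * truncation_factor N k
    / (\<Prod>r=1..n. qpoch q (\<alpha> * x r) (msize n k + N + 1))"

lemma truncation_factor_eq_0:
  assumes "r \<in> {1..n}" "N < k r"
  shows "truncation_factor N k = 0"
proof -
  have "(\<Prod>t<k r. 1 - q ^ (N - t) * (x r / x r)) = 0"
    using assms x_nz by (intro prod_zero bexI[of _ N]) auto
  then have "(\<Prod>s=1..n. \<Prod>t<k r. 1 - q ^ (N - t) * (x s / x r)) = 0"
    by (rule prod_zero[OF finite_atLeastAtMost bexI[OF _ assms(1)]])
  then show ?thesis
    unfolding truncation_factor_def by (rule prod_zero[OF finite_atLeastAtMost bexI[OF _ assms(1)]])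
qed

lemma infsum_truncated_summand:
  assumes nz: "\<And>r m. r \<in> {1..n} \<Longrightarrow> qpoch q (\<alpha> * x r) m \<noteq> 0"
  shows "(\<Sum>\<^sub>\<infinity>k\<in>multi_indices n. truncated_summand \<alpha> N k) = 1"
proof -
  define L where "L = (n + 1) * N"
  define D where "D = (\<Prod>r=1..n. qpoch q (\<alpha> * x r) (L + 1))"
  have D: "D \<noteq> 0" using nz by (simp add: D_def)
  have fin: "finite ({1..n} \<rightarrow>\<^sub>E {..N})"
    by (intro finite_PiE) auto
  have cleared: "truncated_summand \<alpha> N k = cleared_summand N \<alpha> k / D" if k: "k \<in> {1..n} \<rightarrow>\<^sub>E {..N}" for k
  proof -
    define w where "w = msize n k"
    have "w \<le> (\<Sum>r=1..n. N)"
      unfolding w_def msize_def by (rule sum_mono) (use k in auto)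
    then have wL: "{w..w + N} \<subseteq> {..L}" by (auto simp: L_def)
    \<comment> \<open>Extending the fraction by the exponents outside the window makes its
      denominator independent of \<open>k\<close>.\<close>
    have quot: "qpoch q (\<alpha> * x r) w / qpoch q (\<alpha> * x r) (w + N + 1)
        = (\<Prod>M\<in>{..L} - {w..w + N}. 1 - \<alpha> * x r * q ^ M) / qpoch q (\<alpha> * x r) (L + 1)"
      if r: "r \<in> {1..n}" for r
    proof -
      define P where "P = (\<Prod>M\<in>{w..w + N}. 1 - \<alpha> * x r * q ^ M)"
      have "qpoch q (\<alpha> * x r) (w + N + 1) = qpoch q (\<alpha> * x r) w * P"
        using qpoch_add[of q "\<alpha> * x r" w "N + 1"] by (simp add: P_def atLeastLessThanSuc_atLeastAtMost)
      moreover have "qpoch q (\<alpha> * x r) (L + 1) = (\<Prod>M\<in>{..L} - {w..w + N}. 1 - \<alpha> * x r * q ^ M) * P"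
        unfolding P_def qpoch_def using prod.subset_diff[OF wL] by (simp add: lessThan_Suc_atMost)
      ultimately show ?thesis
        using nz[OF r, of "L + 1"] nz[OF r, of "w + N + 1"] by (simp add: field_simps)
    qed
    have eq: "summand n q \<alpha> x k = summand_coeff n q x k * \<alpha> ^ msize n k
        * (\<Prod>r=1..n. (1 - \<alpha> * x r * q ^ (k r + msize n k)) * qpoch q (\<alpha> * x r) (msize n k))"
      by (rule summand_eq_coeff[OF q_nz]) (rule x_nz)
    have "truncated_summand \<alpha> N k = summand_coeff n q x k * truncation_factor N k * \<alpha> ^ w
        * (\<Prod>r=1..n. (1 - \<alpha> * x r * q ^ (k r + w)) * (qpoch q (\<alpha> * x r) w / qpoch q (\<alpha> * x r) (w + N + 1)))"
      unfolding truncated_summand_def eq w_def[symmetric]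
      by (simp add: prod.distrib prod_dividef)
    also have "(\<Prod>r=1..n. (1 - \<alpha> * x r * q ^ (k r + w)) * (qpoch q (\<alpha> * x r) w / qpoch q (\<alpha> * x r) (w + N + 1)))
        = (\<Prod>r=1..n. (1 - \<alpha> * x r * q ^ (k r + w))
          * ((\<Prod>M\<in>{..L} - {w..w + N}. 1 - \<alpha> * x r * q ^ M) / qpoch q (\<alpha> * x r) (L + 1)))"
      by (intro prod.cong refl) (simp only: quot)
    finally show ?thesis
      unfolding cleared_summand_def w_def[symmetric] L_def[symmetric] D_def
      by (simp add: prod.distrib prod_dividef)
  qed
  have "(\<Sum>\<^sub>\<infinity>k\<in>multi_indices n. truncated_summand \<alpha> N k) = (\<Sum>\<^sub>\<infinity>k\<in>{1..n} \<rightarrow>\<^sub>E {..N}. truncated_summand \<alpha> N k)"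
  proof (rule infsum_cong_neutral)
    fix k assume k: "k \<in> multi_indices n - ({1..n} \<rightarrow>\<^sub>E {..N})"
    then obtain r where "r \<in> {1..n}" "N < k r"
      by (auto simp: multi_indices_def PiE_iff not_le)
    then show "truncated_summand \<alpha> N k = 0"
      by (simp add: truncated_summand_def truncation_factor_eq_0)
  qed (auto simp: multi_indices_def PiE_iff)
  also have "\<dots> = (\<Sum>k\<in>{1..n} \<rightarrow>\<^sub>E {..N}. cleared_summand N \<alpha> k / D)"
    using fin by (simp add: cleared)
  also have "\<dots> = 1"
    using sum_cleared_summand[of N \<alpha>] D by (simp add: D_def L_def flip: sum_divide_distrib)
  finally show ?thesis .
qed

lemma truncated_summand_tendsto:
  assumes nz: "\<And>r. r \<in> {1..n} \<Longrightarrow> qpoch_inf q (\<alpha> * x r) \<noteq> 0"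
  shows "(\<lambda>N. truncated_summand \<alpha> N k) \<longlonglongrightarrow> summand n q \<alpha> x k / (\<Prod>r=1..n. qpoch_inf q (\<alpha> * x r))"
proof -
  have "(\<lambda>N. q ^ (N - t)) \<longlonglongrightarrow> 0" for t
    \<comment> \<open>Shifting by \<open>t\<close> removes the truncated subtraction and leaves a
      plain power sequence.\<close>
    by (rule LIMSEQ_offset[of _ t]) (use q_lt_1 in \<open>simp add: LIMSEQ_power_zero\<close>)
  then have "(\<lambda>N. truncation_factor N k) \<longlonglongrightarrow> (\<Prod>r=1..n. \<Prod>s=1..n. \<Prod>t<k r. 1 - 0 * (x s / x r))"
    unfolding truncation_factor_def by (intro tendsto_intros)
  moreover have "(\<lambda>N. qpoch q (\<alpha> * x r) (msize n k + N + 1)) \<longlonglongrightarrow> qpoch_inf q (\<alpha> * x r)" for r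
    using LIMSEQ_ignore_initial_segment[OF qpoch_tendsto[OF q_lt_1], of _ "msize n k + 1"]
    by (simp add: add_ac)
  ultimately have "(\<lambda>N. truncated_summand \<alpha> N k) \<longlonglongrightarrow>
      summand n q \<alpha> x k * (\<Prod>r=1..n. \<Prod>s=1..n. \<Prod>t<k r. 1 - 0 * (x s / x r)) / (\<Prod>r=1..n. qpoch_inf q (\<alpha> * x r))"
    unfolding truncated_summand_def using nz by (intro tendsto_intros) auto
  then show ?thesis by simp
qed

text \<open>If every \<open>k r\<close> is at most \<open>N\<close>, each inner product obeys
  \<open>top_factors_bounded\<close>; otherwise the whole factor is zero.\<close>

lemma truncation_factor_bounded: "\<exists>C\<ge>0. \<forall>N k. norm (truncation_factor N k) \<le> C"
proof -
  define C where "C = (\<Prod>r=1..n. \<Prod>s=1..n. exp (norm (x s / x r) / (1 - norm q)))"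
  have "norm (truncation_factor N k) \<le> C" for N k
  proof (cases "\<forall>r\<in>{1..n}. k r \<le> N")
    case True
    then show ?thesis
      unfolding truncation_factor_def C_def prod_norm[symmetric, of _ "{1..n}"]
      by (intro prod_mono conjI prod_nonneg ballI norm_ge_zero top_factors_bounded[OF q_lt_1]) auto
  next
    case False
    then show ?thesis
      using truncation_factor_eq_0 by (auto simp: C_def not_le intro!: prod_nonneg)
  qed
  moreover have "C \<ge> 0"
    by (auto simp: C_def intro!: prod_nonneg)
  ultimately show ?thesis by blast
qed

text \<open>The Vandermonde numerator and the reciprocal symbols are bounded uniformly in
  \<open>k\<close>. Of the quadratic powers of \<open>q\<close>, one for each \<open>r\<close> is
  kept, enough to beat any geometric growth, and the others are bounded by 1.\<close>

lemma summand_coeff_bounded: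
  assumes nz: "\<And>r s m. r \<in> {1..n} \<Longrightarrow> s \<in> {1..n} \<Longrightarrow> qpoch q (q * x r / x s) m \<noteq> 0"
  shows "\<exists>C\<ge>0. \<forall>k. norm (summand_coeff n q x k)
    \<le> C * (\<Prod>r=1..n. norm (x r ^ (n + 1) * q / (\<Prod>s=1..n. x s)) ^ k r * norm q ^ (k r choose 2))"
proof -
  define X where "X = (\<Prod>s=1..n. x s)"
  define P where "P = {(r,s). 1 \<le> r \<and> r < s \<and> s \<le> n}"
  define V where "V = (\<Prod>(r,s)\<in>P. norm (x s) + norm (x r))"
  obtain C where C: "\<And>r s m. r \<in> {1..n} \<Longrightarrow> s \<in> {1..n} \<Longrightarrow> norm (1 / qpoch q (q * x r / x s) m) \<le> C r s"
    using inverse_qpoch_bounded[OF q_lt_1 nz] by metis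
  define B where "B = (\<Prod>r=1..n. \<Prod>s=1..n. C r s)"
  have C0: "0 \<le> C r s" if "r \<in> {1..n}" "s \<in> {1..n}" for r s
    using order.trans[OF norm_ge_zero C[OF that]] .
  have V0: "V \<ge> 0"
    unfolding V_def by (auto intro!: prod_nonneg)
  have B0: "B \<ge> 0"
    unfolding B_def by (intro prod_nonneg ballI C0)
  have "norm (summand_coeff n q x k) \<le> V / norm (vandermonde n x) * B
    * (\<Prod>r=1..n. norm (x r ^ (n + 1) * q / X) ^ k r * norm q ^ (k r choose 2))" for k
  proof -
    have small: "norm (q ^ j) \<le> 1" for j
      using q_lt_1 by (simp add: norm_power power_le_one)
    have "norm (x s * q ^ k s - x r * q ^ k r) \<le> norm (x s) + norm (x r)" for r s
    proof -
      have "norm (x s * q ^ k s - x r * q ^ k r) \<le> norm (x s) * norm (q ^ k s) + norm (x r) * norm (q ^ k r)"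
        using norm_triangle_ineq4[of "x s * q ^ k s" "x r * q ^ k r"] by (simp add: norm_mult)
      also have "\<dots> \<le> norm (x s) * 1 + norm (x r) * 1"
        by (intro add_mono mult_left_mono small) auto
      finally show ?thesis by simp
    qed
    then have 1: "norm (vandermonde n (\<lambda>r. x r * q ^ k r)) \<le> V"
      unfolding vandermonde_def V_def P_def prod_norm[symmetric] by (intro prod_mono) auto
    have 2: "norm (\<Prod>r=1..n. \<Prod>s=1..n. 1 / qpoch q (q * x r / x s) (k r)) \<le> B"
      unfolding B_def prod_norm[symmetric]
      by (intro prod_mono conjI prod_nonneg ballI norm_ge_zero C) auto
    have 3: "norm (\<Prod>r=1..n. ((-1) ^ n * x r ^ (n + 1) * q / X) ^ k r * q ^ ((n + 1) * (k r choose 2)))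
        \<le> (\<Prod>r=1..n. norm (x r ^ (n + 1) * q / X) ^ k r * norm q ^ (k r choose 2))"
      unfolding prod_norm[symmetric]
    proof (intro prod_mono conjI norm_ge_zero)
      fix r
      have "norm q ^ ((n + 1) * (k r choose 2)) \<le> norm q ^ (k r choose 2)"
        using q_lt_1 by (intro power_decreasing) auto
      then show "norm (((-1) ^ n * x r ^ (n + 1) * q / X) ^ k r * q ^ ((n + 1) * (k r choose 2)))
          \<le> norm (x r ^ (n + 1) * q / X) ^ k r * norm q ^ (k r choose 2)"
        by (simp only: norm_mult norm_power norm_divide norm_minus_cancel norm_one power_one mult_1_left)
           (intro mult_left_mono; simp)
    qed
    \<comment> \<open>The trailing 1 bounds \<open>q ^ (msize n k choose 2)\<close>.\<close>
    have "norm (summand_coeff n q x k) \<le> V / norm (vandermonde n x) * B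
        * (\<Prod>r=1..n. norm (x r ^ (n + 1) * q / X) ^ k r * norm q ^ (k r choose 2)) * 1"
      unfolding summand_coeff_def X_def[symmetric] norm_mult norm_divide
      using 1 2 3 small V0 B0 unfolding norm_mult norm_divide
      by (intro mult_mono divide_right_mono mult_nonneg_nonneg divide_nonneg_nonneg prod_nonneg ballI zero_le_power norm_ge_zero) auto
    then show ?thesis by simp
  qed
  then show ?thesis
    unfolding X_def using V0 B0 by (intro exI[of _ "V / norm (vandermonde n x) * B"]) auto
qed

text \<open>Distributing the power of \<alpha> over the indices turns the bound for the coefficient
  into a product of one-variable series; everything else is bounded uniformly in \<open>N\<close>
  and \<open>k\<close>.\<close>

lemma truncated_summand_dominated:
  assumes nz: "\<And>r s m. r \<in> {1..n} \<Longrightarrow> s \<in> {1..n} \<Longrightarrow> qpoch q (q * x r / x s) m \<noteq> 0"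
    and nz': "\<And>r m. r \<in> {1..n} \<Longrightarrow> qpoch q (\<alpha> * x r) m \<noteq> 0"
  shows "\<exists>M. M summable_on multi_indices n \<and> (\<forall>N k. norm (truncated_summand \<alpha> N k) \<le> M k)"
proof -
  define X where "X = (\<Prod>s=1..n. x s)"
  define a where "a r = norm \<alpha> * norm (x r ^ (n + 1) * q / X)" for r
  define g where "g r j = a r ^ j * norm q ^ (j choose 2)" for r j
  have "\<exists>C\<ge>0. \<forall>k. norm (summand_coeff n q x k)
      \<le> C * (\<Prod>r=1..n. norm (x r ^ (n + 1) * q / X) ^ k r * norm q ^ (k r choose 2))"
    unfolding X_def by (rule summand_coeff_bounded) (rule nz)
  then obtain C1 where C1: "C1 \<ge> 0" "\<And>k. norm (summand_coeff n q x k)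
      \<le> C1 * (\<Prod>r=1..n. norm (x r ^ (n + 1) * q / X) ^ k r * norm q ^ (k r choose 2))"
    by blast
  obtain C2 where C2: "C2 \<ge> 0" "\<And>N k. norm (truncation_factor N k) \<le> C2"
    using truncation_factor_bounded by blast
  have "\<forall>r. \<exists>C. \<forall>m. norm (qpoch q (\<alpha> * x r) m) \<le> C"
    using qpoch_bounded[OF q_lt_1] by blast
  then obtain P where P: "\<And>r m. norm (qpoch q (\<alpha> * x r) m) \<le> P r"
    by metis
  have "\<forall>r\<in>{1..n}. \<exists>C. \<forall>m. norm (1 / qpoch q (\<alpha> * x r) m) \<le> C"
    using inverse_qpoch_bounded[OF q_lt_1 nz'] by blast
  then obtain I where I: "\<And>r m. r \<in> {1..n} \<Longrightarrow> norm (1 / qpoch q (\<alpha> * x r) m) \<le> I r"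
    by metis
  have P0: "0 \<le> P r" for r
    using order.trans[OF norm_ge_zero P] .
  define E where "E = (\<Prod>r=1..n. (1 + norm (\<alpha> * x r)) * P r * I r)"
  have small: "norm (q ^ j) \<le> 1" for j
    using q_lt_1 by (simp add: norm_power power_le_one)
  have a0: "a r \<ge> 0" for r
    by (simp add: a_def)
  have "(\<lambda>k. \<Prod>r=1..n. g r (k r)) summable_on ({1..n} \<rightarrow>\<^sub>E UNIV)"
    using a0 q_lt_1 unfolding g_def
    by (intro summable_on_prod_PiE_nat summable_power_times_quadratic_power) auto
  then have "(\<lambda>k. C1 * C2 * E * (\<Prod>r=1..n. g r (k r))) summable_on multi_indices n"
    unfolding multi_indices_def by (rule summable_on_cmult_right)
  moreover have "norm (truncated_summand \<alpha> N k) \<le> C1 * C2 * E * (\<Prod>r=1..n. g r (k r))" for N k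
  proof -
    define w where "w = msize n k"
    define T where "T = (\<Prod>r=1..n. (1 - \<alpha> * x r * q ^ (k r + w)) * qpoch q (\<alpha> * x r) w
        * (1 / qpoch q (\<alpha> * x r) (w + N + 1)))"
    have eq: "summand n q \<alpha> x k = summand_coeff n q x k * \<alpha> ^ w
        * (\<Prod>r=1..n. (1 - \<alpha> * x r * q ^ (k r + w)) * qpoch q (\<alpha> * x r) w)"
      unfolding w_def by (rule summand_eq_coeff[OF q_nz]) (rule x_nz)
    have split: "truncated_summand \<alpha> N k = (summand_coeff n q x k * \<alpha> ^ w) * truncation_factor N k * T"
      unfolding truncated_summand_def eq T_def w_def[symmetric]
      by (simp add: prod.distrib prod_dividef)
    have T: "norm T \<le> E"
      unfolding T_def E_def prod_norm[symmetric]
    proof (intro prod_mono conjI norm_ge_zero)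
      fix r assume r: "r \<in> {1..n}"
      have "norm (\<alpha> * x r * q ^ (k r + w)) \<le> norm (\<alpha> * x r) * 1"
        unfolding norm_mult[of "\<alpha> * x r"] by (intro mult_left_mono small) auto
      then have "norm (1 - \<alpha> * x r * q ^ (k r + w)) \<le> 1 + norm (\<alpha> * x r)"
        using norm_triangle_ineq4[of 1 "\<alpha> * x r * q ^ (k r + w)"] by simp
      then show "norm ((1 - \<alpha> * x r * q ^ (k r + w)) * qpoch q (\<alpha> * x r) w
          * (1 / qpoch q (\<alpha> * x r) (w + N + 1))) \<le> (1 + norm (\<alpha> * x r)) * P r * I r"
        unfolding norm_mult[of _ "1 / _"] norm_mult[of "1 - _"]
        by (intro mult_mono P I r mult_nonneg_nonneg P0) auto
    qed
    have "norm (\<alpha> ^ w) = (\<Prod>r=1..n. norm \<alpha> ^ k r)"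
      by (simp add: w_def msize_def norm_power power_sum flip: prod_norm)
    then have "norm (summand_coeff n q x k * \<alpha> ^ w)
        \<le> C1 * (\<Prod>r=1..n. norm (x r ^ (n + 1) * q / X) ^ k r * norm q ^ (k r choose 2)) * (\<Prod>r=1..n. norm \<alpha> ^ k r)"
      unfolding norm_mult by (simp only:) (intro mult_right_mono C1(2) prod_nonneg; simp)
    also have "\<dots> = C1 * (\<Prod>r=1..n. g r (k r))"
      by (simp only: g_def a_def power_mult_distrib prod.distrib mult_ac)
    finally have S: "norm (summand_coeff n q x k * \<alpha> ^ w) \<le> C1 * (\<Prod>r=1..n. g r (k r))" .
    have "norm (truncated_summand \<alpha> N k) \<le> C1 * (\<Prod>r=1..n. g r (k r)) * C2 * E"
      unfolding split norm_mult[of _ T] norm_mult[of _ "truncation_factor N k"]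
      using S a0 C1(1) C2(1) by (intro mult_mono T C2(2) mult_nonneg_nonneg prod_nonneg) (auto simp: g_def)
    then show ?thesis by (simp add: mult_ac)
  qed
  ultimately show ?thesis by blast
qed

end

theorem theorem4p3:
  fixes q \<alpha> :: complex and n :: nat and x :: "nat \<Rightarrow> complex"
  assumes "0 < norm q" and "norm q < 1" and "n \<ge> 1"
    and "\<And>r. r \<in> {1..n} \<Longrightarrow> x r \<noteq> 0"
    and "\<And>r. r \<in> {1..n} \<Longrightarrow> qpoch_inf q (\<alpha> * x r) \<noteq> 0"
    and "\<And>r s. 1 \<le> r \<Longrightarrow> r < s \<Longrightarrow> s \<le> n \<Longrightarrow> 1 - x r / x s \<noteq> 0"
    and "\<And>r s m. r \<in> {1..n} \<Longrightarrow> s \<in> {1..n} \<Longrightarrow> qpoch q (q * x r / x s) m \<noteq> 0"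
  shows "summand n q \<alpha> x summable_on multi_indices n
    \<and> 1 = 1 / (\<Prod>r=1..n. qpoch_inf q (\<alpha> * x r)) * (\<Sum>\<^sub>\<infinity>k\<in>multi_indices n. summand n q \<alpha> x k)"
proof -
  \<comment> \<open>The denominators exclude all positive powers of \<open>q\<close> as ratios, in
    both directions since \<open>r\<close> and \<open>s\<close> may be exchanged;
    \<open>distinct\<close> excludes the power 0. Together they give
    \<open>separated\<close>.\<close>
  have ratio: "x r * q ^ (Suc m) \<noteq> x s" if "r \<in> {1..n}" "s \<in> {1..n}" for r s m
    using assms(7)[OF that, of "Suc m"] assms(4)[OF that(1)] assms(4)[OF that(2)] assms(1)
    by (auto simp: qpoch_nz_iff field_simps)
  have distinct: "x r \<noteq> x s" if "r \<in> {1..n}" "s \<in> {1..n}" "r \<noteq> s" for r s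
    using assms(6)[of r s] assms(6)[of s r] assms(4)[OF that(1)] that by (cases "r < s") auto
  interpret generic_points n q x
  proof
    fix r s a b assume rs: "r \<in> {1..n}" "s \<in> {1..n}" "r \<noteq> s"
    consider "a = b" | m where "a = b + Suc m" | m where "b = a + Suc m"
      by (metis less_imp_Suc_add linorder_neqE_nat add_Suc_right)
    then show "x r * q ^ a \<noteq> x s * q ^ b"
    proof cases
      case 1
      then show ?thesis using distinct[OF rs] assms(1) by auto
    next
      case 2
      then show ?thesis using ratio[OF rs(1,2)] assms(1) by (simp add: power_add)
    next
      case 3
      then show ?thesis using ratio[OF rs(2,1)] assms(1) by (simp add: power_add) metis
    qed
  qed (use assms in auto)
  define D where "D = (\<Prod>r=1..n. qpoch_inf q (\<alpha> * x r))"
  have D: "D \<noteq> 0"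
    using assms(5) by (simp add: D_def)
  have nz: "qpoch q (\<alpha> * x r) m \<noteq> 0" if "r \<in> {1..n}" for r m
    using assms(5)[OF that] qpoch_inf_nz_iff[OF q_lt_1] by blast
  obtain M where M: "M summable_on multi_indices n" "\<And>N k. norm (truncated_summand \<alpha> N k) \<le> M k"
    using truncated_summand_dominated[OF assms(7) nz] by blast
  \<comment> \<open>The sums on the left of this limit all equal 1, so their limit is the claim
    divided through by \<open>D\<close>.\<close>
  note conv = infsum_dominated_convergence[OF truncated_summand_tendsto[OF assms(5)] M(2) M(1)]
  have "(\<lambda>k. summand n q \<alpha> x k / D) summable_on multi_indices n"
    unfolding D_def by (rule conv(1))
  then have "(\<lambda>k. D * (summand n q \<alpha> x k / D)) summable_on multi_indices n"
    by (rule summable_on_cmult_right)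
  then have summable: "summand n q \<alpha> x summable_on multi_indices n"
    using D by simp
  have "(\<lambda>N. \<Sum>\<^sub>\<infinity>k\<in>multi_indices n. truncated_summand \<alpha> N k)
      \<longlonglongrightarrow> (\<Sum>\<^sub>\<infinity>k\<in>multi_indices n. summand n q \<alpha> x k / D)"
    unfolding D_def by (rule conv(2))
  moreover have "(\<Sum>\<^sub>\<infinity>k\<in>multi_indices n. truncated_summand \<alpha> N k) = 1" for N
    using nz by (rule infsum_truncated_summand)
  ultimately have "(\<Sum>\<^sub>\<infinity>k\<in>multi_indices n. summand n q \<alpha> x k / D) = 1"
    by (simp add: LIMSEQ_const_iff)
  moreover have "(\<Sum>\<^sub>\<infinity>k\<in>multi_indices n. summand n q \<alpha> x k / D)
      = 1 / D * (\<Sum>\<^sub>\<infinity>k\<in>multi_indices n. summand n q \<alpha> x k)"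
    unfolding divide_inverse by (simp add: mult.commute[of _ "inverse D"] infsum_cmult_right')
  ultimately show ?thesis
    using summable unfolding D_def by simp
qed

end
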